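(* Let $T$ be a tree with unit edge lengths $\ell=1$ and let $\varphi(x)=x-\beta$ with $\beta\in\mathbb{Z}_{\ge0}$, and put $d:=\lfloor\beta/2\rfloor$. If $\beta$ is even, the edge set $L(T,d)$ is an optimal solution of the problem Contraction on the instance $(T,\ell,\varphi)$. If $\beta$ is odd, $L(T,d)\cup\{e\}$ with $e\in E(T)\setminus L(T,d)$ is an optimal solution. These solutions can be computed in time $O(n)$.
   Context: For a tree $T$ and $d\in\mathbb{Z}_{\ge0}$, $L(T,d)$ is the set of all edges $e$ of $T$ having an end vertex $v$ such that every path starting at $v$ and not containing $e$ has at most $d-1$ edges (so $L(T,0)=\emptyset$ and $L(T,1)$ is the set of edges incident to a leaf). For a graph $G=(V,E)$ with edge lengths $\ell$ and $C\subseteq E$: $\ell_C$ equals $0$ on $C$ and $\ell$ elsewhere; $C$ is a $\varphi$-contraction if $\mathrm{dist}_{\ell_C}(u,v)\ge\varphi(\mathrm{dist}_\ell(u,v))$ for all $u,v\in V$. The problem Contraction on $(G,\ell,\varphi)$ asks for a $\varphi$-contraction $C$ maximizing $\Phi(C)=m(G)-m(G/C)$, where $G/C$ is the simple graph obtained by contracting $C$ and deleting loops and parallel edges; on a tree $\Phi(C)=|C|$. *)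

theory Defs
  imports Complex_Main
begin

section \<open>Simple graphs, paths and trees\<close>

definition simple_graph :: "'a set \<Rightarrow> 'a set set \<Rightarrow> bool" where
  "simple_graph V E \<longleftrightarrow> finite V \<and> (\<forall>e\<in>E. \<exists>u\<in>V. \<exists>v\<in>V. u \<noteq> v \<and> e = {u, v})"

text \<open>A path is given by its list of vertices; a single vertex is a path with no edges.\<close>

fun path_edges :: "'a list \<Rightarrow> 'a set list" where
  "path_edges (x # y # xs) = {x, y} # path_edges (y # xs)"
| "path_edges _ = []"

definition is_path :: "'a set \<Rightarrow> 'a set set \<Rightarrow> 'a list \<Rightarrow> bool" where
  "is_path V E p \<longleftrightarrow> p \<noteq> [] \<and> set p \<subseteq> V \<and> distinct p \<and> set (path_edges p) \<subseteq> E"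

definition paths_between :: "'a set \<Rightarrow> 'a set set \<Rightarrow> 'a \<Rightarrow> 'a \<Rightarrow> 'a list set" where
  "paths_between V E u v = {p. is_path V E p \<and> hd p = u \<and> last p = v}"

definition connected_graph :: "'a set \<Rightarrow> 'a set set \<Rightarrow> bool" where
  "connected_graph V E \<longleftrightarrow> V \<noteq> {} \<and> (\<forall>u\<in>V. \<forall>v\<in>V. paths_between V E u v \<noteq> {})"

definition is_cycle :: "'a set \<Rightarrow> 'a set set \<Rightarrow> 'a list \<Rightarrow> bool" where
  "is_cycle V E p \<longleftrightarrow> is_path V E p \<and> length p \<ge> 3 \<and> {last p, hd p} \<in> E"

definition is_tree :: "'a set \<Rightarrow> 'a set set \<Rightarrow> bool" where
  "is_tree V E \<longleftrightarrow> simple_graph V E \<and> connected_graph V E \<and> (\<nexists>p. is_cycle V E p)"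


section \<open>The problem Contraction\<close>

text \<open>
  In a finite graph there are only finitely many paths between two vertices, so for vertices
  of a common component the infimum is a minimum. It carries no meaning for vertices of
  different components; distances are only used in connected graphs.
\<close>

definition graph_dist :: "'a set \<Rightarrow> 'a set set \<Rightarrow> ('a set \<Rightarrow> real) \<Rightarrow> 'a \<Rightarrow> 'a \<Rightarrow> real" where
  "graph_dist V E l u v = (INF p\<in>paths_between V E u v. sum_list (map l (path_edges p)))"

definition contracted_length :: "('a set \<Rightarrow> real) \<Rightarrow> 'a set set \<Rightarrow> 'a set \<Rightarrow> real" where
  "contracted_length l C e = (if e \<in> C then 0 else l e)"

definition is_contraction ::
  "'a set \<Rightarrow> 'a set set \<Rightarrow> ('a set \<Rightarrow> real) \<Rightarrow> (real \<Rightarrow> real) \<Rightarrow> 'a set set \<Rightarrow> bool" where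
  "is_contraction V E l \<phi> C \<longleftrightarrow> C \<subseteq> E \<and>
     (\<forall>u\<in>V. \<forall>v\<in>V. graph_dist V E (contracted_length l C) u v \<ge> \<phi> (graph_dist V E l u v))"

text \<open>
  The vertices of \<open>G/C\<close> are the vertex sets of the connected components of \<open>(V, C)\<close>.
  Edges inside a component would become loops and are dropped; parallel edges coincide
  because the edges of \<open>G/C\<close> form a set.
\<close>

definition component :: "'a set \<Rightarrow> 'a set set \<Rightarrow> 'a \<Rightarrow> 'a set" where
  "component V C u = {v. paths_between V C u v \<noteq> {}}"

definition quotient_edges :: "'a set \<Rightarrow> 'a set set \<Rightarrow> 'a set set \<Rightarrow> 'a set set set" where
  "quotient_edges V E C =
     {{component V C u, component V C v} |u v. {u, v} \<in> E \<and> component V C u \<noteq> component V C v}"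

definition contraction_value :: "'a set \<Rightarrow> 'a set set \<Rightarrow> 'a set set \<Rightarrow> int" where
  "contraction_value V E C = int (card E) - int (card (quotient_edges V E C))"

definition optimal_contraction ::
  "'a set \<Rightarrow> 'a set set \<Rightarrow> ('a set \<Rightarrow> real) \<Rightarrow> (real \<Rightarrow> real) \<Rightarrow> 'a set set \<Rightarrow> bool" where
  "optimal_contraction V E l \<phi> C \<longleftrightarrow> is_contraction V E l \<phi> C \<and>
     (\<forall>C'. is_contraction V E l \<phi> C' \<longrightarrow> contraction_value V E C' \<le> contraction_value V E C)"


section \<open>The edge set \<open>L(T, d)\<close>\<close>

definition outer_edges :: "'a set \<Rightarrow> 'a set set \<Rightarrow> nat \<Rightarrow> 'a set set" where
  "outer_edges V E d = {e \<in> E. \<exists>v\<in>e. \<forall>p.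
     is_path V E p \<and> hd p = v \<and> e \<notin> set (path_edges p) \<longrightarrow>
     int (length (path_edges p)) \<le> int d - 1}"


section \<open>Programs with running times\<close>

text \<open>
  Running times refer to a word RAM, presented as a while language with finitely many
  registers and arrays, all holding natural numbers. Every node of an evaluated expression
  and every assignment costs one step. A store is only possible if the stored value is at
  most \<open>w\<close>, the largest number that fits into a machine word; programs that try to store a
  larger value get stuck. Subtraction is truncated.
\<close>

datatype expr =
    Lit nat
  | Reg nat
  | Read nat expr
  | Add expr expr
  | Sub expr expr

datatype test =
    LessThan expr expr
  | Equal expr expr
  | Neg test
  | Conj test test

datatype prog =
    Nop
  | Assign nat expr
  | Store nat expr expr
  | Seq prog prog
  | Cond test prog prog
  | Loop test prog

text \<open>A state consists of the contents of the registers and of the arrays.\<close>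

type_synonym state = "(nat \<Rightarrow> nat) \<times> (nat \<Rightarrow> nat \<Rightarrow> nat)"

fun expr_val :: "expr \<Rightarrow> state \<Rightarrow> nat" where
  "expr_val (Lit k) s = k"
| "expr_val (Reg x) s = fst s x"
| "expr_val (Read a e) s = snd s a (expr_val e s)"
| "expr_val (Add e f) s = expr_val e s + expr_val f s"
| "expr_val (Sub e f) s = expr_val e s - expr_val f s"

fun expr_cost :: "expr \<Rightarrow> nat" where
  "expr_cost (Lit k) = 1"
| "expr_cost (Reg x) = 1"
| "expr_cost (Read a e) = 1 + expr_cost e"
| "expr_cost (Add e f) = 1 + expr_cost e + expr_cost f"
| "expr_cost (Sub e f) = 1 + expr_cost e + expr_cost f"

fun test_val :: "test \<Rightarrow> state \<Rightarrow> bool" where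
  "test_val (LessThan e f) s \<longleftrightarrow> expr_val e s < expr_val f s"
| "test_val (Equal e f) s \<longleftrightarrow> expr_val e s = expr_val f s"
| "test_val (Neg b) s \<longleftrightarrow> \<not> test_val b s"
| "test_val (Conj b c) s \<longleftrightarrow> test_val b s \<and> test_val c s"

fun test_cost :: "test \<Rightarrow> nat" where
  "test_cost (LessThan e f) = 1 + expr_cost e + expr_cost f"
| "test_cost (Equal e f) = 1 + expr_cost e + expr_cost f"
| "test_cost (Neg b) = 1 + test_cost b"
| "test_cost (Conj b c) = 1 + test_cost b + test_cost c"

text \<open>
  \<open>exec w c s t s'\<close>: with word bound \<open>w\<close>, program \<open>c\<close> started in \<open>s\<close> terminates in \<open>s'\<close>
  after \<open>t\<close> steps.
\<close>

inductive exec :: "nat \<Rightarrow> prog \<Rightarrow> state \<Rightarrow> nat \<Rightarrow> state \<Rightarrow> bool" for w :: nat where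
  Nop: "exec w Nop s 1 s"
| Assign: "expr_val e s \<le> w \<Longrightarrow>
    exec w (Assign x e) s (1 + expr_cost e) ((fst s)(x := expr_val e s), snd s)"
| Store: "expr_val i s \<le> w \<Longrightarrow> expr_val e s \<le> w \<Longrightarrow>
    exec w (Store a i e) s (1 + expr_cost i + expr_cost e)
      (fst s, (snd s)(a := (snd s a)(expr_val i s := expr_val e s)))"
| Seq: "exec w c s t1 s1 \<Longrightarrow> exec w d s1 t2 s2 \<Longrightarrow> exec w (Seq c d) s (t1 + t2) s2"
| CondTrue: "test_val b s \<Longrightarrow> exec w c s t s' \<Longrightarrow> exec w (Cond b c d) s (test_cost b + t) s'"
| CondFalse: "\<not> test_val b s \<Longrightarrow> exec w d s t s' \<Longrightarrow> exec w (Cond b c d) s (test_cost b + t) s'"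
| LoopFalse: "\<not> test_val b s \<Longrightarrow> exec w (Loop b c) s (test_cost b) s"
| LoopTrue: "test_val b s \<Longrightarrow> exec w c s t1 s1 \<Longrightarrow> exec w (Loop b c) s1 t2 s2 \<Longrightarrow>
    exec w (Loop b c) s (test_cost b + t1 + t2) s2"

text \<open>
  A tree on the vertices \<open>0, \<dots>, n - 1\<close> is given to a program as a list of its edges, in any
  order and with the end vertices of each edge in any order: the \<open>i\<close>-th edge joins
  the \<open>i\<close>-th entries of arrays 0 and 1. Registers 0 and 1 hold \<open>n\<close> and \<open>\<beta>\<close>; everything else
  is initially 0. A program returns a set of edges by marking their positions with 1 in array 2.
\<close>

definition edge_of :: "nat \<times> nat \<Rightarrow> nat set" where
  "edge_of uv = {fst uv, snd uv}"

definition edges_of :: "(nat \<times> nat) list \<Rightarrow> nat set set" where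
  "edges_of es = edge_of ` set es"

definition tree_encoding :: "nat \<Rightarrow> (nat \<times> nat) list \<Rightarrow> bool" where
  "tree_encoding n es \<longleftrightarrow> distinct (map edge_of es) \<and> is_tree {..<n} (edges_of es)"

definition input_state :: "nat \<Rightarrow> nat \<Rightarrow> (nat \<times> nat) list \<Rightarrow> state" where
  "input_state n \<beta> es =
    ((\<lambda>_. 0)(0 := n, 1 := \<beta>),
     (\<lambda>_ _. 0)(0 := \<lambda>i. if i < length es then fst (es ! i) else 0,
               1 := \<lambda>i. if i < length es then snd (es ! i) else 0))"

definition output_edges :: "(nat \<times> nat) list \<Rightarrow> state \<Rightarrow> nat set set" where
  "output_edges es s = {edge_of (es ! i) |i. i < length es \<and> snd s 2 i = 1}"

end

theory Submission
  imports Defs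
begin

text \<open>
  In a tree the path between \<open>u\<close> and \<open>v\<close> consists of the edges separating \<open>u\<close> from
  \<open>v\<close>, so \<open>C\<close> is a contraction for \<open>\<phi>(x) = x - \<beta>\<close> iff every path contains at most
  \<open>\<beta>\<close> edges of \<open>C\<close>.

  Upper bound: for an edge \<open>e\<close> of such a \<open>C\<close>, count the edges of \<open>C\<close> on paths that leave
  an end of \<open>e\<close> without using \<open>e\<close>, and orient \<open>e\<close> towards the end where the maximum
  \<open>k\<close> is smaller. Then \<open>k < \<lfloor>\<beta>/2\<rfloor>\<close>, except for at most one edge if \<open>\<beta>\<close> is
  odd. The sides of two edges with the same \<open>k\<close> are disjoint, and the side of \<open>e\<close>, together
  with \<open>e\<close>, contains an edge beyond which the longest path of the whole tree has exactly \<open>k\<close>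
  edges; this gives an injection into \<open>L(T, \<lfloor>\<beta>/2\<rfloor>)\<close>.

  Algorithm: peel off edges at leaves as long as the longest peeled path ending at the leaf has fewer
  than \<open>d\<close> edges. Storing for every vertex the number and the sum of the indices of its
  remaining edges makes the last remaining edge available without adjacency lists. Heights are
  stored as maxima, so the order of peeling does not matter. Replacing \<open>d\<close> by
  \<open>min d n\<close> keeps the halving of \<open>\<beta>\<close> linear in \<open>n\<close>.
\<close>

subsection \<open>Paths and separating edges in trees\<close>

text \<open>Walks compose and reverse without any repair, whereas concatenated simple paths would
  have to be shortened each time.\<close>

definition reach :: "'a set set \<Rightarrow> 'a \<Rightarrow> 'a \<Rightarrow> bool" where
  "reach F = (\<lambda>x y. {x, y} \<in> F)\<^sup>*\<^sup>*"

lemma reach_refl [simp]: "reach F x x"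
  by (simp add: reach_def)

lemma reach_edge: "{x, y} \<in> F \<Longrightarrow> reach F x y"
  by (auto simp: reach_def)

lemma reach_trans: "reach F x y \<Longrightarrow> reach F y z \<Longrightarrow> reach F x z"
  by (auto simp: reach_def)

lemma reach_sym: "reach F x y \<Longrightarrow> reach F y x"
  unfolding reach_def
  by (rule sympD[OF symp_rtranclp]) (auto simp: symp_def insert_commute)

lemma reach_mono: "reach F x y \<Longrightarrow> F \<subseteq> G \<Longrightarrow> reach G x y"
  unfolding reach_def by (erule rtranclp_mono[THEN predicate2D, rotated]) auto

lemma path_edges_append:
  "path_edges (xs @ y # zs) = path_edges (xs @ [y]) @ path_edges (y # zs)"
  by (induction xs rule: path_edges.induct) auto

lemma length_path_edges [simp]: "length (path_edges p) = length p - 1"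
  by (induction p rule: path_edges.induct) auto

lemma nth_path_edges: "Suc i < length p \<Longrightarrow> path_edges p ! i = {p ! i, p ! Suc i}"
proof (induction p arbitrary: i rule: path_edges.induct)
  case (1 x y xs)
  then show ?case by (cases i) auto
qed auto

lemma path_edges_take: "path_edges (take (Suc i) p) = take i (path_edges p)"
proof (induction p arbitrary: i rule: path_edges.induct)
  case (1 x y xs)
  then show ?case by (cases i) auto
qed auto

lemma path_edges_drop: "path_edges (drop i p) = drop i (path_edges p)"
  by (rule nth_equalityI) (auto simp: nth_path_edges)

lemma path_edges_subset: "e \<in> set (path_edges p) \<Longrightarrow> e \<subseteq> set p"
  by (induction p rule: path_edges.induct) auto

lemma distinct_path_edges: "distinct p \<Longrightarrow> distinct (path_edges p)"
  by (induction p rule: path_edges.induct) (auto dest: path_edges_subset)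

lemma path_reach:
  "p \<noteq> [] \<Longrightarrow> set (path_edges p) \<subseteq> F \<Longrightarrow> reach F (hd p) (last p)"
  by (induction p rule: path_edges.induct) (auto intro: reach_trans reach_edge)

text \<open>The walk is followed edge by edge while a simple path is kept: a vertex already on the
  path causes it to be cut back to that vertex.\<close>

lemma reach_path:
  assumes "reach F u v" "u \<in> V" "\<And>e. e \<in> F \<Longrightarrow> e \<subseteq> V"
  obtains p where "is_path V F p" "hd p = u" "last p = v"
proof -
  have "\<exists>p. is_path V F p \<and> hd p = u \<and> last p = v"
    using assms(1) unfolding reach_def
  proof (induction rule: rtranclp_induct)
    case base
    show ?case using assms(2) by (intro exI[of _ "[u]"]) (auto simp: is_path_def)
  next
    case (step y z)
    then obtain p where p: "is_path V F p" "hd p = u" "last p = y" by blast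
    show ?case
    proof (cases "z \<in> set p")
      case True
      then obtain xs ys where xs: "p = xs @ z # ys" by (auto simp: in_set_conv_decomp)
      have "is_path V F (xs @ [z])"
        using p(1) path_edges_append[of xs z ys] by (auto simp: is_path_def xs)
      moreover have "hd (xs @ [z]) = u" using p(2) xs by (cases xs) auto
      ultimately show ?thesis by force
    next
      case False
      obtain xs where xs: "p = xs @ [y]"
        using p by (metis append_butlast_last_id is_path_def)
      have "is_path V F (p @ [z])"
        using p(1) False step(2) assms(3)[OF step(2)] path_edges_append[of xs y "[z]"]
        by (auto simp: is_path_def xs)
      then show ?thesis using p by (intro exI[of _ "p @ [z]"]) (auto simp: is_path_def)
    qed
  qed
  then show ?thesis using that by blast
qed

section \<open>Edges separating two vertices of a tree\<close>

locale tree =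
  fixes V :: "'a set" and E :: "'a set set"
  assumes tree: "is_tree V E"
begin

lemma finite_V: "finite V" and V_nonempty: "V \<noteq> {}"
  using tree by (auto simp: is_tree_def simple_graph_def connected_graph_def)

lemma edgeE:
  assumes "e \<in> E"
  obtains u v where "u \<in> V" "v \<in> V" "u \<noteq> v" "e = {u, v}"
  using assms tree by (auto simp: is_tree_def simple_graph_def)

lemma edge_end:
  assumes "e \<in> E" "v \<in> e"
  obtains w where "e = {v, w}" "v \<noteq> w" "v \<in> V" "w \<in> V"
  using assms by (elim edgeE) auto

lemma edge_subset: "e \<in> E \<Longrightarrow> e \<subseteq> V"
  by (auto elim: edgeE)

lemma finite_E: "finite E"
  by (rule finite_subset[of _ "Pow V"]) (auto dest: edge_subset simp: finite_V)

lemma reach_all: "u \<in> V \<Longrightarrow> v \<in> V \<Longrightarrow> reach E u v"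
proof -
  assume "u \<in> V" "v \<in> V"
  then have "paths_between V E u v \<noteq> {}"
    using tree by (simp add: is_tree_def connected_graph_def)
  then obtain p where "is_path V E p" "hd p = u" "last p = v"
    by (auto simp: paths_between_def)
  then show ?thesis using path_reach[of p E] by (auto simp: is_path_def)
qed

text \<open>A path from \<open>u\<close> to \<open>v\<close> without \<open>{u, v}\<close> has at
  least three vertices, and \<open>{u, v}\<close> closes it to a cycle.\<close>

lemma bridge:
  assumes "{u, v} \<in> E"
  shows "\<not> reach (E - {{u, v}}) u v"
proof
  assume "reach (E - {{u, v}}) u v"
  then obtain p where p: "is_path V (E - {{u, v}}) p" "hd p = u" "last p = v"
    using reach_path[of "E - {{u, v}}" u v V] edge_subset assms by blast
  have "u \<noteq> v" using assms by (auto elim: edgeE)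
  with p obtain xs where xs: "p = u # xs" "xs \<noteq> []" by (cases p) (auto simp: is_path_def split: if_splits)
  have "length xs \<noteq> 1" using p xs by (auto simp: length_Suc_conv is_path_def)
  with xs have "length p \<ge> 3" by (cases xs) (auto simp: Suc_le_eq)
  then have "is_cycle V E p" using p assms by (auto simp: is_cycle_def is_path_def insert_commute)
  then show False using tree by (auto simp: is_tree_def)
qed

text \<open>The edge set of the path between two vertices, described as the set of separating edges so
  that no uniqueness of paths is needed.\<close>

definition sep :: "'a \<Rightarrow> 'a \<Rightarrow> 'a set set" where
  "sep u v = {e \<in> E. \<not> reach (E - {e}) u v}"

lemma sep_subset: "sep u v \<subseteq> E"
  by (auto simp: sep_def)

lemma finite_sep [simp]: "finite (sep u v)"
  using finite_subset[OF sep_subset finite_E] .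

lemma sep_refl [simp]: "sep u u = {}"
  by (auto simp: sep_def)

lemma sep_commute: "sep u v = sep v u"
  by (auto simp: sep_def dest: reach_sym)

lemma sep_trans: "e \<notin> sep u v \<Longrightarrow> e \<notin> sep v w \<Longrightarrow> e \<notin> sep u w"
  by (auto simp: sep_def dest: reach_trans)

lemma sep_edge: "{u, v} \<in> E \<Longrightarrow> sep u v = {{u, v}}"
  using bridge by (auto simp: sep_def intro: reach_edge)

text \<open>Along a walk from \<open>a\<close> to \<open>x\<close>, every vertex remains reachable
  from \<open>a\<close> or from \<open>b\<close> without \<open>{a, b}\<close>: a use of this edge
  only leads to one of its own ends.\<close>

lemma sep_ends:
  assumes "{a, b} \<in> E" "x \<in> V"
  shows "{a, b} \<notin> sep x a \<or> {a, b} \<notin> sep x b"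
proof -
  have "a \<in> V" using edge_subset[OF assms(1)] by auto
  then have "reach E a x" using assms(2) reach_all by auto
  then have "reach (E - {{a, b}}) a x \<or> reach (E - {{a, b}}) b x"
    unfolding reach_def
  proof (induction rule: rtranclp_induct)
    case (step y z)
    show ?case
    proof (cases "{y, z} = {a, b}")
      case True
      then show ?thesis by (auto simp: doubleton_eq_iff)
    next
      case False
      with step have "{y, z} \<in> E - {{a, b}}" by auto
      with step.IH show ?thesis by (auto intro: rtranclp.rtrancl_into_rtrancl)
    qed
  qed auto
  then show ?thesis by (auto simp: sep_def dest: reach_sym)
qed

lemma sep_ends_iff:
  assumes "{a, b} \<in> E" "x \<in> V"
  shows "{a, b} \<in> sep x a \<longleftrightarrow> {a, b} \<notin> sep x b"
  using sep_ends[OF assms] sep_edge[OF assms(1)] sep_trans[of "{a, b}" a x b] sep_commute[of x a]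
  by auto

text \<open>If \<open>f\<close> separated \<open>a\<close> from \<open>v\<close>, it would separate
  \<open>a\<close> from both ends of \<open>e\<close>, since \<open>e\<close> and \<open>f\<close>
  differ. A walk from \<open>a\<close> to \<open>b\<close> without \<open>f\<close> would then never
  use \<open>e\<close>, although \<open>e\<close> separates \<open>a\<close> from
  \<open>b\<close>.\<close>

lemma sep_passes:
  assumes "e \<in> sep a b" "f \<notin> sep a b" "v \<in> e" "f \<in> E"
  shows "f \<notin> sep a v"
proof
  assume f: "f \<in> sep a v"
  have e: "e \<in> E" "\<not> reach (E - {e}) a b" using assms by (auto simp: sep_def)
  obtain w where w: "e = {v, w}" using e assms(3) by (auto elim: edge_end)
  have ef: "e \<noteq> f" using assms by auto
  have nr: "\<not> reach (E - {f}) a v" using f by (auto simp: sep_def)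
  then have nr2: "\<not> reach (E - {f}) a w"
    using e(1) ef w reach_edge[of w v "E - {f}"] by (auto intro: reach_trans simp: insert_commute)
  have "reach (E - {f}) a b" using assms by (auto simp: sep_def)
  then have "reach (E - {e}) a b \<and> reach (E - {f}) a b"
    unfolding reach_def
  proof (induction rule: rtranclp_induct)
    case (step y z)
    have "{y, z} \<noteq> e"
      using step.IH nr nr2 unfolding w reach_def by (auto simp: doubleton_eq_iff)
    with step have "{y, z} \<in> E - {e}" by auto
    with step show ?case by (auto intro: rtranclp.rtrancl_into_rtrancl)
  qed auto
  with e show False by auto
qed

text \<open>The paths from \<open>a\<close> to \<open>x\<close> and from \<open>b\<close> to
  \<open>y\<close> are joined through \<open>{a, b}\<close>. They share no edge, because an end of a
  common edge would be connected to both \<open>a\<close> and \<open>b\<close> without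
  \<open>{a, b}\<close>.\<close>

lemma sep_bridge:
  assumes e: "{a, b} \<in> E" and x: "{a, b} \<notin> sep a x" "x \<in> V" and y: "{a, b} \<notin> sep b y" "y \<in> V"
  shows "sep x y = insert {a, b} (sep a x \<union> sep b y)"
    and "sep a x \<inter> sep b y = {}"
proof -
  have ab: "a \<in> V" "b \<in> V" "sep a b = {{a, b}}" "sep b a = {{a, b}}"
    using edge_subset[OF e] sep_edge[OF e] sep_commute by auto
  have False if g: "g \<in> sep a x" "g \<in> sep b y" for g
  proof -
    obtain v where v: "v \<in> g" using g sep_subset by (blast elim: edgeE)
    have "{a, b} \<notin> sep a v" "{a, b} \<notin> sep b v"
      using sep_passes[OF g(1) x(1) v e] sep_passes[OF g(2) y(1) v e] by auto
    with sep_trans[of "{a,b}" a v b] show False using ab sep_commute by auto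
  qed
  then show disj: "sep a x \<inter> sep b y = {}" by auto
  have *: "g \<in> sep x y \<longleftrightarrow> g = {a, b} \<or> g \<in> sep a x \<or> g \<in> sep b y" for g
  proof (cases "g = {a, b}")
    case True
    have "{a, b} \<in> sep x y"
      using x y ab sep_trans[of "{a,b}" a x y] sep_trans[of "{a,b}" a y b] sep_commute by auto
    then show ?thesis using True by auto
  next
    case False
    then have nab: "g \<notin> sep a b" "g \<notin> sep b a" using ab by auto
    have "g \<in> sep x y \<longleftrightarrow> g \<in> sep a x \<or> g \<in> sep b y"
    proof
      assume "g \<in> sep x y"
      then show "g \<in> sep a x \<or> g \<in> sep b y"
        using sep_trans nab sep_commute by metis
    next
      \<comment> \<open>By disjointness \<open>g\<close> separates exactly one of the two pairs, so
        non-separation of \<open>x\<close> and \<open>y\<close> would contradict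
        \<open>sep_trans\<close>.\<close>
      assume "g \<in> sep a x \<or> g \<in> sep b y"
      then show "g \<in> sep x y"
        using disj sep_trans nab sep_commute by (metis IntI empty_iff)
    qed
    with False show ?thesis by simp
  qed
  show "sep x y = insert {a, b} (sep a x \<union> sep b y)"
    using * by blast
qed

text \<open>The rest of a path from \<open>u\<close> to \<open>v\<close> never returns to
  \<open>u\<close>, so it joins \<open>w\<close> to \<open>v\<close> without the first edge. A
  detour from \<open>u\<close> to \<open>v\<close> around this edge would contradict
  \<open>bridge\<close>.\<close>

lemma sep_first_edge:
  assumes "u \<in> V" "v \<in> V" "u \<noteq> v"
  obtains w where "{u, w} \<in> sep u v"
proof -
  obtain p where p: "is_path V E p" "hd p = u" "last p = v"
    using reach_path[OF reach_all[OF assms(1,2)] assms(1)] edge_subset by blast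
  then obtain w xs where xs: "p = u # w # xs"
    using assms(3) by (cases p rule: path_edges.cases) (auto simp: is_path_def split: if_splits)
  show ?thesis
  proof (rule that[of w], unfold sep_def, safe)
    show uw: "{u, w} \<in> E" using p xs by (auto simp: is_path_def)
    assume r: "reach (E - {{u, w}}) u v"
    have "{u, w} \<notin> set (path_edges (w # xs))"
      using p xs by (auto dest: path_edges_subset simp: is_path_def)
    then have "reach (E - {{u, w}}) w v"
      using path_reach[of "w # xs" "E - {{u, w}}"] p xs by (auto simp: is_path_def)
    then have "reach (E - {{u, w}}) u w" using r reach_trans reach_sym by metis
    then show False using bridge[OF uw] by simp
  qed
qed

text \<open>This is uniqueness of paths. No path can avoid a separating edge. Conversely, a path
  uses each of its edges once, so the pieces before and after an edge avoid it, while the edge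
  separates its own ends.\<close>

lemma path_edges_sep:
  assumes p: "is_path V E p"
  shows "set (path_edges p) = sep (hd p) (last p)"
proof
  show "sep (hd p) (last p) \<subseteq> set (path_edges p)"
  proof
    fix e assume e: "e \<in> sep (hd p) (last p)"
    show "e \<in> set (path_edges p)"
    proof (rule ccontr)
      assume "e \<notin> set (path_edges p)"
      then have "reach (E - {e}) (hd p) (last p)"
        using p by (intro path_reach) (auto simp: is_path_def)
      with e show False by (auto simp: sep_def)
    qed
  qed
  show "set (path_edges p) \<subseteq> sep (hd p) (last p)"
  proof
    fix e assume e: "e \<in> set (path_edges p)"
    then obtain i where i: "Suc i < length p" "path_edges p ! i = e"
      by (metis in_set_conv_nth length_path_edges less_diff_conv Suc_eq_plus1)
    let ?a = "p ! i" and ?b = "p ! Suc i"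
    have e_eq: "e = {?a, ?b}" using i nth_path_edges by metis
    have eE: "e \<in> E" using e p by (auto simp: is_path_def)
    have dis: "distinct (path_edges p)" using p distinct_path_edges by (auto simp: is_path_def)
    have li: "i < length (path_edges p)" using i by auto
    have "e \<notin> set (take i (path_edges p))" "e \<notin> set (drop (Suc i) (path_edges p))"
      using dis id_take_nth_drop[OF li] i(2) by (metis disjoint_insert(1) distinct.simps(2) distinct_append list.simps(15))+
    moreover have "set (take i (path_edges p)) \<subseteq> E" "set (drop (Suc i) (path_edges p)) \<subseteq> E"
      using p set_take_subset set_drop_subset unfolding is_path_def by fast+
    ultimately have "reach (E - {e}) (hd (take (Suc i) p)) (last (take (Suc i) p))"
      "reach (E - {e}) (hd (drop (Suc i) p)) (last (drop (Suc i) p))"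
      using i p by (intro path_reach; auto simp: path_edges_take path_edges_drop)+
    then have "e \<notin> sep (hd p) ?a" "e \<notin> sep ?b (last p)"
      using i p by (auto simp: is_path_def sep_def hd_drop_conv_nth take_Suc_conv_app_nth hd_append last_drop hd_conv_nth split: if_splits)
    moreover have "e \<in> sep ?a ?b" using sep_edge eE e_eq by auto
    ultimately show "e \<in> sep (hd p) (last p)" using sep_trans sep_commute by metis
  qed
qed

lemma path_exists:
  assumes "u \<in> V" "v \<in> V"
  obtains p where "is_path V E p" "hd p = u" "last p = v"
  using reach_path[OF reach_all[OF assms] assms(1)] edge_subset by blast

section \<open>Distances, contractions and their values\<close>

text \<open>All paths between \<open>u\<close> and \<open>v\<close> have the same edges, so the
  infimum runs over a nonempty family with a single value.\<close>

lemma graph_dist_eq: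
  assumes "u \<in> V" "v \<in> V"
  shows "graph_dist V E l u v = sum l (sep u v)"
proof -
  have "sum_list (map l (path_edges p)) = sum l (sep u v)" if "p \<in> paths_between V E u v" for p
    using that path_edges_sep[of p] distinct_path_edges[of p]
    by (simp add: paths_between_def sum_list_distinct_conv_sum_set is_path_def)
  moreover have "paths_between V E u v \<noteq> {}"
    using path_exists[OF assms] unfolding paths_between_def by blast
  ultimately show ?thesis
    unfolding graph_dist_def by (simp add: image_constant_conv cong: image_cong)
qed

text \<open>With unit lengths, contracting \<open>C\<close> shortens a distance by the number of
  edges of \<open>C\<close> on the path.\<close>

lemma is_contraction_iff:
  "is_contraction V E (\<lambda>_. 1) (\<lambda>x. x - real \<beta>) C \<longleftrightarrow>
     C \<subseteq> E \<and> (\<forall>u\<in>V. \<forall>v\<in>V. card (sep u v \<inter> C) \<le> \<beta>)"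
proof -
  have "sum (contracted_length (\<lambda>_. 1) C) (sep u v) = card (sep u v) - real (card (sep u v \<inter> C))" for u v
  proof -
    have "sum (contracted_length (\<lambda>_. 1) C) (sep u v) = real (card (sep u v - C))"
      unfolding contracted_length_def by (simp add: sum.If_cases Diff_eq)
    then show ?thesis by (simp add: card_Diff_subset_Int of_nat_diff card_mono)
  qed
  then show ?thesis
    unfolding is_contraction_def by (simp add: graph_dist_eq)
qed

lemma component_eq:
  assumes "C \<subseteq> E" "u \<in> V"
  shows "component V C u = {v. reach C u v}"
proof -
  have "paths_between V C u v \<noteq> {} \<longleftrightarrow> reach C u v" for v
  proof
    assume "paths_between V C u v \<noteq> {}"
    then obtain p where "is_path V C p" "hd p = u" "last p = v"
      by (auto simp: paths_between_def)
    then show "reach C u v" using path_reach[of p C] by (auto simp: is_path_def)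
  next
    assume "reach C u v"
    moreover have "e \<subseteq> V" if "e \<in> C" for e using that assms edge_subset by auto
    ultimately obtain p where "is_path V C p" "hd p = u" "last p = v"
      using reach_path[of C u v V] assms(2) by blast
    then show "paths_between V C u v \<noteq> {}" by (auto simp: paths_between_def)
  qed
  then show ?thesis by (auto simp: component_def)
qed

lemma component_eq_iff:
  assumes "C \<subseteq> E" "u \<in> V" "v \<in> V"
  shows "component V C u = component V C v \<longleftrightarrow> reach C u v"
proof
  assume "component V C u = component V C v"
  then have "v \<in> {x. reach C u x}" using assms by (simp add: component_eq)
  then show "reach C u v" by simp
next
  assume "reach C u v"
  then have "reach C u x \<longleftrightarrow> reach C v x" for x using reach_trans reach_sym by metis
  then show "component V C u = component V C v" using assms by (simp add: component_eq)
qed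

text \<open>Contraction creates neither loops nor parallel edges outside \<open>C\<close>: an edge
  outside \<open>C\<close> whose ends are joined by \<open>C\<close> would not be a bridge, and two
  parallel edges \<open>e\<close> and \<open>f\<close> would give a way around \<open>e\<close>
  through \<open>C\<close> and \<open>f\<close>.\<close>

lemma contraction_value_eq:
  assumes C: "C \<subseteq> E"
  shows "contraction_value V E C = int (card C)"
proof -
  let ?q = "\<lambda>e. component V C ` e"
  have no_reach: "\<not> reach C u v" if "{u, v} \<in> E - C" for u v
    using that C bridge[of u v] reach_mono[of C u v "E - {{u, v}}"] by blast
  have in_V: "u \<in> V" "v \<in> V" if "{u, v} \<in> E" for u v
    using edge_subset[OF that] by auto
  have comp: "component V C u \<noteq> component V C v \<longleftrightarrow> {u, v} \<notin> C" if "{u, v} \<in> E" for u v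
    using component_eq_iff[OF C in_V[OF that]] no_reach that reach_edge[of u v C] by blast
  have "quotient_edges V E C = ?q ` (E - C)"
  proof (intro equalityI subsetI)
    fix X assume "X \<in> quotient_edges V E C"
    then obtain u v where "X = {component V C u, component V C v}" "{u, v} \<in> E - C"
      unfolding quotient_edges_def using comp by blast
    then show "X \<in> ?q ` (E - C)" by (intro image_eqI[of _ _ "{u, v}"]) auto
  next
    fix X assume "X \<in> ?q ` (E - C)"
    then obtain e where e: "e \<in> E" "e \<notin> C" "X = ?q e" by auto
    then obtain u v where "e = {u, v}" by (auto elim: edgeE)
    with e comp[of u v] show "X \<in> quotient_edges V E C"
      unfolding quotient_edges_def by auto
  qed
  moreover have "inj_on ?q (E - C)"
  proof (rule inj_onI, rule ccontr)
    fix e f assume ef: "e \<in> E - C" "f \<in> E - C" "?q e = ?q f" "e \<noteq> f"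
    have "e \<in> E" using ef by simp
    then obtain a b where e: "e = {a, b}" by (rule edgeE)
    have "\<exists>a' b'. f = {a', b'} \<and> component V C a = component V C a' \<and> component V C b = component V C b'"
    proof -
      have "f \<in> E" using ef by simp
      then obtain a' b' where f: "f = {a', b'}" by (rule edgeE)
      from ef(3) have "(component V C a = component V C a' \<and> component V C b = component V C b') \<or>
          (component V C a = component V C b' \<and> component V C b = component V C a')"
        unfolding e f by (auto simp: doubleton_eq_iff)
      then show ?thesis unfolding f by (metis insert_commute)
    qed
    then obtain a' b' where f: "f = {a', b'}" and "component V C a = component V C a'" "component V C b = component V C b'"
      by blast
    then have "reach C a a'" "reach C b' b"
      using component_eq_iff[OF C] ef edge_subset[of e] edge_subset[of f] unfolding e f by (auto dest: reach_sym)
    then have "reach (E - {e}) a a'" "reach (E - {e}) b' b"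
      using C ef(1) reach_mono[of C _ _ "E - {e}"] by blast+
    moreover have "reach (E - {e}) a' b'" using ef f by (auto intro: reach_edge)
    ultimately have "reach (E - {e}) a b" using reach_trans by metis
    then show False using bridge ef e by auto
  qed
  ultimately have "card (quotient_edges V E C) = card E - card C"
    using C finite_E by (simp add: card_image card_Diff_subset finite_subset)
  then show ?thesis
    unfolding contraction_value_def using C finite_E by (simp add: card_mono of_nat_diff)
qed

text \<open>With \<open>r\<close> as root, each edge is assigned its end away from \<open>r\<close>;
  this is a bijection onto the other vertices.\<close>

lemma card_V: "card V = Suc (card E)"
proof -
  obtain r where r: "r \<in> V" using V_nonempty by auto
  define far where "far e = (THE v. v \<in> e \<and> e \<in> sep r v)" for e
  have far: "far e \<in> e \<and> e \<in> sep r (far e)" if eE: "e \<in> E" for e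
  proof -
    obtain a b where e: "e = {a, b}" "a \<noteq> b" using eE by (rule edgeE)
    have "\<exists>!v. v \<in> e \<and> e \<in> sep r v"
      using sep_ends_iff[of a b r] eE r e by auto
    then show ?thesis unfolding far_def by (rule theI')
  qed
  \<comment> \<open>Only one edge at \<open>v\<close> leads towards \<open>r\<close>: with
    \<open>a\<close> the other end of \<open>e\<close>, the path from \<open>a\<close> to
    \<open>r\<close> avoids \<open>e\<close>, yet it would use \<open>f\<close> and hence pass
    through \<open>v\<close>.\<close>
  have uniq: "e = f" if "e \<in> sep r v" "f \<in> sep r v" "v \<in> e" "v \<in> f" for e f v
  proof (rule ccontr)
    assume "e \<noteq> f"
    have E: "e \<in> E" "f \<in> E" using that sep_subset by auto
    obtain a where a: "e = {v, a}" using edge_end[OF E(1) \<open>v \<in> e\<close>] by metis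
    have ea: "e \<notin> sep a r" using sep_ends_iff[of v a r] that E r sep_commute unfolding a by auto
    have "f \<notin> sep a v" using sep_edge[of v a] \<open>e \<noteq> f\<close> E sep_commute unfolding a by auto
    then have "f \<in> sep a r" using sep_trans[of f v a r] that sep_commute by auto
    then have "e \<notin> sep a v" using sep_passes[of f a r e v] ea that E by auto
    then show False using sep_edge[of v a] E sep_commute unfolding a by auto
  qed
  have "bij_betw far E (V - {r})"
  proof (rule bij_betw_imageI)
    show "inj_on far E" using far uniq by (metis inj_onI)
    show "far ` E = V - {r}"
    proof (intro equalityI subsetI)
      fix v assume "v \<in> far ` E"
      then obtain e where e: "e \<in> E" "v = far e" by auto
      with far[of e] have "v \<in> e" "e \<in> sep r v" by auto
      with e edge_subset show "v \<in> V - {r}" by auto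
    next
      fix v assume v: "v \<in> V - {r}"
      then obtain w where w: "{v, w} \<in> sep v r" using sep_first_edge[of v r] r by auto
      then have "{v, w} \<in> E" using sep_subset by auto
      moreover have "far {v, w} = v"
        using far[OF \<open>{v, w} \<in> E\<close>] w sep_ends_iff[of v w r] \<open>{v, w} \<in> E\<close> r sep_commute by auto
      ultimately show "v \<in> far ` E" by (metis imageI)
    qed
  qed
  then have "card E = card (V - {r})" by (rule bij_betw_same_card)
  then show ?thesis using r finite_V by (metis card_Suc_Diff1)
qed

text \<open>A path is determined by its ends, so paths starting at \<open>v\<close> are replaced by
  their last vertices. The integer bound \<open>d - 1\<close> turns into \<open>< d\<close>, which
  is also right for \<open>d = 0\<close>.\<close>

lemma outer_edges_eq:
  "outer_edges V E d = {e \<in> E. \<exists>v\<in>e. \<forall>x\<in>V. e \<notin> sep v x \<longrightarrow> card (sep v x) < d}"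
proof -
  have "(\<forall>p. is_path V E p \<and> hd p = v \<and> e \<notin> set (path_edges p) \<longrightarrow>
        int (length (path_edges p)) \<le> int d - 1) \<longleftrightarrow>
      (\<forall>x\<in>V. e \<notin> sep v x \<longrightarrow> card (sep v x) < d)" (is "?L \<longleftrightarrow> ?R") if v: "v \<in> V" for e v
  proof
    assume L: ?L
    show ?R
    proof (intro ballI impI)
      fix x assume x: "x \<in> V" "e \<notin> sep v x"
      obtain p where p: "is_path V E p" "hd p = v" "last p = x" using path_exists[OF v x(1)] .
      have "length (path_edges p) = card (sep v x)"
        using path_edges_sep[OF p(1)] p distinct_path_edges[of p]
        by (metis distinct_card is_path_def)
      then show "card (sep v x) < d"
        using L p x path_edges_sep[OF p(1)] by force
    qed
  next
    assume R: ?R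
    show ?L
    proof (intro allI impI)
      fix p assume p: "is_path V E p \<and> hd p = v \<and> e \<notin> set (path_edges p)"
      then have "length (path_edges p) = card (sep v (last p))"
        using path_edges_sep[of p] distinct_path_edges[of p] by (metis distinct_card is_path_def)
      moreover have "last p \<in> V" using p by (auto simp: is_path_def)
      ultimately show "int (length (path_edges p)) \<le> int d - 1"
        using R p path_edges_sep[of p] by force
    qed
  qed
  then show ?thesis
    unfolding outer_edges_def using edge_subset by blast
qed


subsection \<open>Optimality of the outer edges\<close>

text \<open>For an edge \<open>e\<close> with end \<open>v\<close>, this is the component of
  \<open>v\<close> after deletion of \<open>e\<close>.\<close>

definition side :: "'a \<Rightarrow> 'a set \<Rightarrow> 'a set" where
  "side v e = {x \<in> V. e \<notin> sep v x}"

text \<open>The parameter \<open>C\<close> lets one notion measure both contracted edges and, for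
  \<open>C = E\<close>, path lengths in the whole tree.\<close>

definition height :: "'a set set \<Rightarrow> 'a \<Rightarrow> 'a set \<Rightarrow> nat" where
  "height C v e = Max ((\<lambda>x. card (sep v x \<inter> C)) ` side v e)"

lemma side_subset: "side v e \<subseteq> V"
  by (auto simp: side_def)

lemma finite_side [simp]: "finite (side v e)"
  using finite_subset[OF side_subset finite_V] .

lemma side_self: "v \<in> V \<Longrightarrow> v \<in> side v e"
  by (simp add: side_def)

lemma height_ge: "x \<in> side v e \<Longrightarrow> card (sep v x \<inter> C) \<le> height C v e"
  unfolding height_def by (rule Max_ge) auto

lemma height_attained:
  assumes "v \<in> V"
  obtains x where "x \<in> side v e" "card (sep v x \<inter> C) = height C v e"
proof -
  have "height C v e \<in> (\<lambda>x. card (sep v x \<inter> C)) ` side v e"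
    unfolding height_def using side_self[OF assms] by (intro Max_in) auto
  then show ?thesis using that by auto
qed

lemma height_mono:
  assumes "v \<in> V" "C \<subseteq> D"
  shows "height C v e \<le> height D v e"
proof -
  obtain x where x: "x \<in> side v e" "card (sep v x \<inter> C) = height C v e"
    using height_attained[OF assms(1)] .
  have "card (sep v x \<inter> C) \<le> card (sep v x \<inter> D)"
    using assms(2) by (intro card_mono) auto
  then show ?thesis using height_ge[OF x(1), of D] x(2) by simp
qed

lemma outer_edges_height:
  "outer_edges V E d = {e \<in> E. \<exists>v\<in>e. height E v e < d}"
proof -
  have "(\<forall>x\<in>V. e \<notin> sep v x \<longrightarrow> card (sep v x) < d) \<longleftrightarrow> height E v e < d"
    if "e \<in> E" "v \<in> e" for e v
  proof -
    have v: "v \<in> V" using that edge_subset by auto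
    have sepE: "sep v x \<inter> E = sep v x" for x using sep_subset by auto
    show ?thesis
    proof
      assume L: "\<forall>x\<in>V. e \<notin> sep v x \<longrightarrow> card (sep v x) < d"
      obtain x where "x \<in> side v e" "card (sep v x \<inter> E) = height E v e"
        using height_attained[OF v] .
      then show "height E v e < d" using L by (auto simp: side_def sepE)
    next
      assume "height E v e < d"
      then show "\<forall>x\<in>V. e \<notin> sep v x \<longrightarrow> card (sep v x) < d"
        using height_ge[of _ v e E] by (fastforce simp: side_def sepE)
    qed
  qed
  then show ?thesis unfolding outer_edges_eq by blast
qed

lemma side_compl:
  assumes "{v, w} \<in> E"
  shows "side w {v, w} = V - side v {v, w}"
  using sep_ends_iff[OF assms] sep_commute by (auto simp: side_def)

text \<open>A path from \<open>v'\<close> into the side of \<open>v\<close> runs through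
  \<open>w\<close>, then crosses \<open>{v, w}\<close>, and never uses \<open>e'\<close>. The
  crossing accounts for the extra one in the heights.\<close>

lemma height_step:
  assumes e: "{v, w} \<in> E" and e': "e' \<in> E" "v' \<in> e'" "e' \<noteq> {v, w}"
    and v': "v' \<notin> side v {v, w}" and w: "w \<in> side v' e'"
  shows "side v {v, w} \<subseteq> side v' e'"
    and "{v, w} \<in> C \<Longrightarrow> Suc (height C v {v, w}) \<le> height C v' e'"
proof -
  let ?e = "{v, w}"
  have V: "v \<in> V" "w \<in> V" "v' \<in> V" using edge_subset[OF e] edge_subset[OF e'(1)] e' by auto
  have v'w: "?e \<notin> sep w v'" using v' V side_compl[OF e] by (auto simp: side_def)
  have vv': "?e \<in> sep v v'" using v' V by (auto simp: side_def)
  have *: "sep v' x = insert ?e (sep w v' \<union> sep v x) \<and> sep w v' \<inter> sep v x = {} \<and> x \<in> side v' e'"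
    if "x \<in> side v ?e" for x
  proof -
    have x: "x \<in> V" "?e \<notin> sep v x" using that by (auto simp: side_def)
    have wv: "{w, v} = ?e" by auto
    have 1: "sep v' x = insert ?e (sep w v' \<union> sep v x)" "sep w v' \<inter> sep v x = {}"
      using sep_bridge[of w v v' x] e x v'w V unfolding wv by auto
    \<comment> \<open>A path from \<open>v\<close> to \<open>x\<close> through \<open>e'\<close>
      would reach \<open>v'\<close> without \<open>?e\<close>, which separates \<open>v\<close> from
      \<open>v'\<close>.\<close>
    have "e' \<notin> sep v x"
      using sep_passes[of e' v x ?e v'] x e e' vv' by auto
    moreover have "e' \<notin> sep w v'" using w sep_commute by (auto simp: side_def)
    ultimately show ?thesis using 1 x e' by (auto simp: side_def)
  qed
  then show "side v ?e \<subseteq> side v' e'" by auto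
  assume C: "?e \<in> C"
  obtain x where x: "x \<in> side v ?e" "card (sep v x \<inter> C) = height C v ?e"
    using height_attained[OF V(1)] .
  have "insert ?e (sep v x \<inter> C) \<subseteq> sep v' x \<inter> C" using *[OF x(1)] C by auto
  then have "card (insert ?e (sep v x \<inter> C)) \<le> card (sep v' x \<inter> C)"
    by (intro card_mono) auto
  moreover have "?e \<notin> sep v x \<inter> C" using x by (auto simp: side_def)
  ultimately have "Suc (height C v ?e) \<le> card (sep v' x \<inter> C)" using x by simp
  also have "\<dots> \<le> height C v' e'" using *[OF x(1)] by (intro height_ge) auto
  finally show "Suc (height C v ?e) \<le> height C v' e'" .
qed

text \<open>For a common vertex \<open>x\<close>, the path from \<open>v'\<close> to
  \<open>x\<close> crosses \<open>e\<close> and so meets \<open>v\<close> without using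
  \<open>e'\<close>; but \<open>e'\<close> separates \<open>v'\<close> from
  \<open>v\<close>.\<close>

lemma side_disjoint:
  assumes "e \<in> E" "e' \<in> E" "v \<in> e" "v' \<in> e'" "v \<notin> side v' e'" "v' \<notin> side v e"
  shows "side v e \<inter> side v' e' = {}"
proof (rule ccontr)
  have V: "v \<in> V" "v' \<in> V" using assms edge_subset by auto
  assume "side v e \<inter> side v' e' \<noteq> {}"
  then obtain x where x: "x \<in> V" "e \<notin> sep v x" "e' \<notin> sep v' x" by (auto simp: side_def)
  have "e \<in> sep v v'" "e' \<in> sep v' v" using assms V by (auto simp: side_def)
  then have "e \<in> sep v' x" using x sep_trans[of e v x v'] sep_commute by auto
  then show False using sep_passes[of e v' x e' v] x assms \<open>e' \<in> sep v' v\<close> by auto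
qed

lemma same_side:
  assumes "e \<in> E" "{v', w'} \<in> E" "e \<noteq> {v', w'}" "v \<in> V"
  shows "v' \<in> side v e \<longleftrightarrow> w' \<in> side v e"
proof -
  have "v' \<in> V" "w' \<in> V" "e \<notin> sep v' w'" "e \<notin> sep w' v'"
    using edge_subset[OF assms(2)] sep_edge[OF assms(2)] sep_commute assms(3) by auto
  then show ?thesis using sep_trans[of e v v' w'] sep_trans[of e v w' v'] by (auto simp: side_def)
qed

text \<open>With minimal heights chosen, no two edges of \<open>C\<close> can face each other: either side would
  have to be higher than the other.\<close>

lemma not_facing:
  assumes "e \<in> C" "e' \<in> C" "C \<subseteq> E" "e = {v, w}" "e' = {v', w'}" "e \<noteq> e'"
    and min: "height C v e \<le> height C w e" "height C v' e' \<le> height C w' e'"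
  shows "v \<notin> side v' e' \<or> v' \<notin> side v e"
proof (rule ccontr)
  assume "\<not> ?thesis"
  then have f: "v \<in> side v' e'" "v' \<in> side v e" by auto
  have E: "e \<in> E" "e' \<in> E" using assms by auto
  have comm: "{w, v} = e" "{w', v'} = e'" using assms by auto
  have "v \<notin> side w' e'" "v' \<notin> side w e"
    using f side_compl[of v' w'] side_compl[of v w] E assms by auto
  then have "Suc (height C w' e') \<le> height C v e" "Suc (height C w e) \<le> height C v' e'"
    using height_step(2)[of w' v' e v C] height_step(2)[of w v e' v' C] f E assms comm by auto
  with min show False by simp
qed

text \<open>Among the pairs of an edge and an end whose side lies within \<open>side v e\<close> and
  whose height is at least \<open>k\<close>, one with the smallest side is taken. Were its height
  larger than \<open>k\<close>, the first edge of a longest path would give a smaller side and lose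
  only one in height.\<close>

lemma exact_height:
  assumes "e \<in> E" "v \<in> e" "k \<le> height E v e"
  obtains y f where "f \<in> E" "y \<in> f" "height E y f = k" "side y f \<subseteq> side v e"
proof -
  let ?P = "\<lambda>p. snd p \<in> E \<and> fst p \<in> snd p \<and> k \<le> height E (fst p) (snd p) \<and> side (fst p) (snd p) \<subseteq> side v e"
  have "\<exists>p. ?P p" using assms by (intro exI[of _ "(v, e)"]) auto
  then obtain p where P: "?P p" and least: "\<And>q. ?P q \<Longrightarrow> card (side (fst p) (snd p)) \<le> card (side (fst q) (snd q))"
    using ex_has_least_nat[of ?P _ "\<lambda>p. card (side (fst p) (snd p))"] by blast
  obtain y f where p: "p = (y, f)" by (cases p)
  have f: "f \<in> E" "y \<in> f" "k \<le> height E y f" "side y f \<subseteq> side v e" using P by (auto simp: p)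
  have y: "y \<in> V" using f edge_subset by auto
  have "height E y f = k"
  proof (rule ccontr)
    assume "height E y f \<noteq> k"
    then have gt: "k < height E y f" using f by auto
    obtain x where x: "x \<in> side y f" "card (sep y x \<inter> E) = height E y f"
      using height_attained[OF y] .
    have "y \<noteq> x" using x gt by auto
    then obtain z where z: "{y, z} \<in> sep y x"
      using sep_first_edge[of y x] x y by (auto simp: side_def)
    let ?g = "{y, z}"
    have g: "?g \<in> E" "{z, y} = ?g" using z sep_subset by auto
    have zV: "z \<in> V" using edge_subset[OF g(1)] by auto
    have fg: "f \<noteq> ?g" using z x by (auto simp: side_def)
    have xV: "x \<in> V" using x by (auto simp: side_def)
    have xz: "?g \<notin> sep z x" using z sep_ends_iff[OF g(1) xV] sep_commute by auto
    have "y \<notin> side z ?g" using side_compl[OF g(1)] side_self[OF y] by auto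
    moreover have "y \<in> side y f" using side_self[OF y] .
    moreover have sub: "side z ?g \<subseteq> side y f"
      using height_step(1)[of z y f y] g f fg \<open>y \<notin> side z ?g\<close> \<open>y \<in> side y f\<close> by auto
    ultimately have "side z ?g \<subset> side y f" by blast
    then have "card (side z ?g) < card (side y f)" by (rule psubset_card_mono[rotated]) simp
    moreover have "k \<le> height E z ?g"
    proof -
      have "sep y x = insert ?g (sep z x)"
        using sep_bridge(1)[of y z y x] g y xV xz by simp
      then have "card (sep y x) \<le> Suc (card (sep z x))" by (simp add: card_insert_le_m1)
      moreover have "sep y x \<inter> E = sep y x" "sep z x \<inter> E = sep z x" using sep_subset by auto
      moreover have "x \<in> side z ?g" using xz xV by (auto simp: side_def)
      ultimately show ?thesis using height_ge[of x z ?g E] x gt by simp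
    qed
    ultimately show False using least[of "(z, ?g)"] g sub f by (auto simp: p)
  qed
  then show ?thesis using that f by blast
qed

section \<open>Upper bounds on the size of a contraction\<close>

text \<open>Extremal paths on the two sides, joined through \<open>{v, w}\<close>, form one path
  containing all the counted edges of \<open>C\<close>.\<close>

lemma contraction_heights:
  assumes "is_contraction V E (\<lambda>_. 1) (\<lambda>x. x - real \<beta>) C" "{v, w} \<in> C"
  shows "height C v {v, w} + height C w {v, w} + 1 \<le> \<beta>"
proof -
  have C: "C \<subseteq> E" and card: "\<And>x y. x \<in> V \<Longrightarrow> y \<in> V \<Longrightarrow> card (sep x y \<inter> C) \<le> \<beta>"
    using assms(1) unfolding is_contraction_iff by auto
  have e: "{v, w} \<in> E" using C assms(2) by auto
  have V: "v \<in> V" "w \<in> V" using edge_subset[OF e] by auto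
  obtain x where x: "x \<in> side v {v, w}" "card (sep v x \<inter> C) = height C v {v, w}"
    using height_attained[OF V(1)] .
  obtain y where y: "y \<in> side w {v, w}" "card (sep w y \<inter> C) = height C w {v, w}"
    using height_attained[OF V(2)] .
  have xy: "x \<in> V" "y \<in> V" "{v, w} \<notin> sep v x" "{v, w} \<notin> sep w y"
    using x y by (auto simp: side_def)
  have "sep x y = insert {v, w} (sep v x \<union> sep w y)" "sep v x \<inter> sep w y = {}"
    using sep_bridge[OF e] xy by auto
  then have "sep x y \<inter> C = insert {v, w} ((sep v x \<inter> C) \<union> (sep w y \<inter> C))"
    "(sep v x \<inter> C) \<inter> (sep w y \<inter> C) = {}" using assms(2) by auto
  then have "card (sep x y \<inter> C) = Suc (height C v {v, w} + height C w {v, w})"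
    using xy x y by (simp add: card_Un_disjoint)
  then show ?thesis using card[OF xy(1,2)] by simp
qed

text \<open>Each low edge is sent to an edge of the same height, now measured in the whole tree, on
  the side of its end of smaller height. Equal images with the same end contradict the disjointness
  or nesting of sides; with opposite ends, the two sides would cover the tree and the edges would
  face each other.\<close>

lemma card_low_edges_le:
  assumes C: "C \<subseteq> E"
  shows "card {e \<in> C. \<exists>v\<in>e. height C v e < d} \<le> card (outer_edges V E d)"
proof -
  let ?C = "{e \<in> C. \<exists>v\<in>e. height C v e < d}"
  have "\<exists>v w. e = {v, w} \<and> height C v e \<le> height C w e" if e: "e \<in> C" for e
  proof -
    obtain a b where "e = {a, b}" using e C by (blast elim: edgeE)
    then show ?thesis by (metis insert_commute linear)
  qed
  then obtain v w where vw: "\<And>e. e \<in> C \<Longrightarrow> e = {v e, w e} \<and> height C (v e) e \<le> height C (w e) e"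
    by metis
  have low: "height C (v e) e < d" if "e \<in> ?C" for e
    using that vw[of e] by (auto elim!: allE) (metis insertE le_less_trans singletonD)
  \<comment> \<open>The height counted in \<open>C\<close> is at most the height in the whole tree,
    so \<open>exact_height\<close> applies to it.\<close>
  have "\<exists>y f. f \<in> E \<and> y \<in> f \<and> height E y f = height C (v e) e \<and> side y f \<subseteq> side (v e) e"
    if e: "e \<in> C" for e
  proof -
    have "e \<in> E" "v e \<in> e" using e C vw[OF e] by auto
    then have "v e \<in> V" using edge_subset by auto
    then show ?thesis
      using exact_height[OF \<open>e \<in> E\<close> \<open>v e \<in> e\<close> height_mono[OF _ C]] by metis
  qed
  then obtain y f where yf: "\<And>e. e \<in> C \<Longrightarrow> f e \<in> E \<and> y e \<in> f e \<and>
      height E (y e) (f e) = height C (v e) e \<and> side (y e) (f e) \<subseteq> side (v e) e"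
    by metis
  have "f ` ?C \<subseteq> outer_edges V E d"
  proof
    fix g assume "g \<in> f ` ?C"
    then obtain e where e: "e \<in> ?C" "g = f e" by blast
    then have "height E (y e) g < d" "g \<in> E" "y e \<in> g" using yf[of e] low[of e] by auto
    then show "g \<in> outer_edges V E d" unfolding outer_edges_height by blast
  qed
  moreover have "inj_on f ?C"
  proof (rule inj_onI, rule ccontr)
    fix e e' assume "e \<in> ?C" "e' \<in> ?C" and ff: "f e = f e'" and ne: "e \<noteq> e'"
    then have eC: "e \<in> C" "e' \<in> C" and E: "e \<in> E" "e' \<in> E" using C by auto
    let ?v = "v e" and ?w = "w e" and ?v' = "v e'" and ?w' = "w e'"
    have ee: "e = {?v, ?w}" "e' = {?v', ?w'}" using vw eC by auto
    have V: "?v \<in> V" "?w \<in> V" "?v' \<in> V" "?w' \<in> V"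
      using edge_subset[OF E(1)] edge_subset[OF E(2)] ee by blast+
    have out: "?w \<notin> side ?v e" "?w' \<notin> side ?v' e'"
      using side_compl[of ?v ?w] side_compl[of ?v' ?w'] E ee side_self[OF V(2)] side_self[OF V(4)]
      by auto
    have same: "?v' \<in> side ?v e \<longleftrightarrow> ?w' \<in> side ?v e" "?v \<in> side ?v' e' \<longleftrightarrow> ?w \<in> side ?v' e'"
      using same_side[of e ?v' ?w' ?v] same_side[of e' ?v ?w ?v'] E ee V ne by auto
    have mem: "?v \<in> e" "?v' \<in> e'" using ee by auto
    \<comment> \<open>Sides that do not face each other are disjoint or nested; in the nested case
      the outer one is strictly higher by \<open>height_step\<close>.\<close>
    have key: "side ?v e \<inter> side ?v' e' = {} \<or>
        (height C ?v e \<noteq> height C ?v' e' \<and> (side ?v e \<subseteq> side ?v' e' \<or> side ?v' e' \<subseteq> side ?v e))"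
    proof -
      have nf: "?v \<notin> side ?v' e' \<or> ?v' \<notin> side ?v e"
        using not_facing[OF eC C ee(1,2) ne] vw eC by blast
      consider "?v \<notin> side ?v' e'" "?v' \<notin> side ?v e" | "?v \<in> side ?v' e'" "?v' \<notin> side ?v e"
        | "?v \<notin> side ?v' e'" "?v' \<in> side ?v e" using nf by blast
      then show ?thesis
      proof cases
        case 1
        then show ?thesis using side_disjoint[OF E mem] by auto
      next
        case 2
        then show ?thesis
          using height_step(1)[of ?v ?w e' ?v'] height_step(2)[of ?v ?w e' ?v' C] same E eC ne ee mem by auto
      next
        case 3
        then show ?thesis
          using height_step(1)[of ?v' ?w' e ?v] height_step(2)[of ?v' ?w' e ?v C] same E eC ne ee mem by auto
      qed
    qed
    have yV: "y e \<in> V" using yf[OF eC(1)] edge_subset by auto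
    show False
    proof (cases "y e = y e'")
      case True
      then have "y e \<in> side ?v e \<inter> side ?v' e'"
        using yf[OF eC(1)] yf[OF eC(2)] side_self[OF yV, of "f e"] ff by auto
      moreover have "height C ?v e = height C ?v' e'"
        using yf[OF eC(1)] yf[OF eC(2)] ff True by auto
      ultimately show False using key by auto
    next
      case False
      have fE: "f e \<in> E" and ye: "y e \<in> f e" "y e' \<in> f e"
        using yf[OF eC(1)] yf[OF eC(2)] ff by auto
      obtain z where "f e = {y e, z}" using edge_end[OF fE ye(1)] by metis
      then have fe: "f e = {y e, y e'}" using ye False by auto
      have "side (y e') (f e) = V - side (y e) (f e)"
        using side_compl[of "y e" "y e'"] fE fe by auto
      \<comment> \<open>Both sides of the common image edge together are \<open>V\<close>. Hence
        \<open>?w\<close> and \<open>?w'\<close>, which lie outside their own sides, lie in each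
        other's, and by \<open>same\<close> so do \<open>?v\<close> and \<open>?v'\<close>.\<close>
      then have cover: "V \<subseteq> side ?v e \<union> side ?v' e'"
        using yf[OF eC(1)] yf[OF eC(2)] ff by auto
      then have "?w \<in> side ?v' e'" "?w' \<in> side ?v e" using out V by auto
      then show False
        using not_facing[OF eC C ee(1,2) ne] vw eC same by blast
    qed
  qed
  moreover have "finite (outer_edges V E d)"
    using finite_E by (auto simp: outer_edges_def)
  ultimately show ?thesis using card_inj_on_le[of f ?C "outer_edges V E d"] by simp
qed

text \<open>The two heights of an edge of \<open>C\<close> add up to at most
  \<open>\<beta> - 1\<close>, so for even \<open>\<beta>\<close> one of them is below
  \<open>\<beta> div 2\<close>.\<close>

lemma contraction_card_even:
  assumes C: "is_contraction V E (\<lambda>_. 1) (\<lambda>x. x - real \<beta>) C" and "even \<beta>"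
  shows "card C \<le> card (outer_edges V E (\<beta> div 2))"
proof -
  have CE: "C \<subseteq> E" using C unfolding is_contraction_iff by auto
  have "\<exists>v\<in>e. height C v e < \<beta> div 2" if e: "e \<in> C" for e
  proof -
    obtain v w where vw: "e = {v, w}" using e CE by (blast elim: edgeE)
    have "height C v e + height C w e + 1 \<le> \<beta>" using contraction_heights[OF C] e vw by auto
    then have "height C v e < \<beta> div 2 \<or> height C w e < \<beta> div 2" using \<open>even \<beta>\<close> by presburger
    then show ?thesis using vw by auto
  qed
  then have "{e \<in> C. \<exists>v\<in>e. height C v e < \<beta> div 2} = C" by auto
  then show ?thesis using card_low_edges_le[OF CE, of "\<beta> div 2"] by simp
qed

text \<open>An edge that is not low has both heights equal to \<open>\<beta> div 2\<close>. Two such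
  edges could be oriented towards each other, against \<open>not_facing\<close>, so there is at most
  one.\<close>

lemma contraction_card_odd:
  assumes C: "is_contraction V E (\<lambda>_. 1) (\<lambda>x. x - real \<beta>) C" and "odd \<beta>"
  shows "card C \<le> Suc (card (outer_edges V E (\<beta> div 2)))"
proof -
  let ?d = "\<beta> div 2"
  let ?H = "{e \<in> C. \<forall>v\<in>e. \<not> height C v e < ?d}"
  have CE: "C \<subseteq> E" using C unfolding is_contraction_iff by auto
  then have fin: "finite C" using finite_E finite_subset by auto
  have *: "height C v {v, w} = ?d \<and> height C w {v, w} = ?d" if "{v, w} \<in> ?H" for v w
  proof -
    have "{v, w} \<in> C" using that by blast
    then have "height C v {v, w} + height C w {v, w} + 1 \<le> \<beta>" using contraction_heights[OF C] by auto
    moreover have "?d \<le> height C v {v, w}" "?d \<le> height C w {v, w}" using that by auto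
    ultimately show ?thesis using \<open>odd \<beta>\<close> by presburger
  qed
  have "e = e'" if H: "e \<in> ?H" "e' \<in> ?H" for e e'
  proof (rule ccontr)
    assume ne: "e \<noteq> e'"
    have eC: "e \<in> C" "e' \<in> C" using H by auto
    then have E: "e \<in> E" "e' \<in> E" using CE by auto
    obtain a b where ab: "e = {a, b}" "a \<in> V" "b \<in> V" using E(1) by (rule edgeE)
    obtain a' b' where ab': "e' = {a', b'}" "a' \<in> V" "b' \<in> V" using E(2) by (rule edgeE)
    have "a' \<in> side a e \<or> a' \<in> side b e" "a \<in> side a' e' \<or> a \<in> side b' e'"
      using side_compl[of a b] side_compl[of a' b'] ab ab' E by auto
    \<comment> \<open>Here \<open>v\<close> is the end of \<open>e\<close> whose side contains
      \<open>e'\<close>, and \<open>v'\<close> the end of \<open>e'\<close> whose side contains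
      \<open>e\<close>.\<close>
    then obtain v w v' w' where vw: "e = {v, w}" "e' = {v', w'}" "v \<in> V" "v' \<in> V"
      and 1: "a' \<in> side v e" "a \<in> side v' e'"
      using ab ab' by (metis insert_commute)
    have "v \<in> {a, b}" "v' \<in> {a', b'}" using vw ab ab' by auto
    then have "v' \<in> side v e" "v \<in> side v' e'"
      using same_side[of e a' b' v] same_side[of e' a b v'] 1 ab ab' E ne vw(3,4) by auto
    moreover have "height C v e \<le> height C w e" "height C v' e' \<le> height C w' e'"
      using *[of v w] *[of v' w'] H unfolding vw(1)[symmetric] vw(2)[symmetric] by simp_all
    ultimately show False
      using not_facing[OF eC CE vw(1,2) ne] by blast
  qed
  then have "card ?H \<le> 1"
    using fin card_le_Suc0_iff_eq[of ?H] by simp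
  moreover have "card C = card ?H + card {e \<in> C. \<exists>v\<in>e. height C v e < ?d}"
    using fin by (subst card_Un_disjoint[symmetric]) (auto intro: arg_cong[of _ _ card])
  ultimately show ?thesis using card_low_edges_le[OF CE, of ?d] by simp
qed

text \<open>On a path with edges \<open>e\<^sub>1, \<dots>, e\<^sub>m\<close> the edge \<open>e\<^sub>i\<close> can only lie in \<open>L(T, d)\<close> if
  \<open>i \<le> d\<close> or \<open>i > m - d\<close>.\<close>

lemma card_sep_outer:
  assumes "u \<in> V" "v \<in> V"
  shows "card (sep u v \<inter> outer_edges V E d) \<le> 2 * d"
proof -
  obtain p where p: "is_path V E p" "hd p = u" "last p = v" using path_exists[OF assms] .
  let ?m = "length (path_edges p)"
  have dis: "distinct (path_edges p)" "distinct p" using p distinct_path_edges by (auto simp: is_path_def)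
  have "sep u v \<inter> outer_edges V E d \<subseteq> (\<lambda>i. path_edges p ! i) ` ({..<d} \<union> {?m - d..<?m})"
  proof
    fix e assume e: "e \<in> sep u v \<inter> outer_edges V E d"
    then have "e \<in> set (path_edges p)" using path_edges_sep[OF p(1)] p by simp
    then obtain i where i: "i < ?m" "e = path_edges p ! i" by (metis in_set_conv_nth)
    then have i': "Suc i < length p" by auto
    let ?a = "p ! i" and ?b = "p ! Suc i"
    have e_eq: "e = {?a, ?b}" using i nth_path_edges[OF i'] by metis
    have sub: "set (take i (path_edges p)) \<subseteq> E" "set (drop (Suc i) (path_edges p)) \<subseteq> E"
      using p set_take_subset set_drop_subset unfolding is_path_def by fast+
    have "is_path V E (take (Suc i) p)" "is_path V E (drop (Suc i) p)"
      using p i' sub unfolding is_path_def path_edges_take path_edges_drop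
      by (auto dest: in_set_takeD in_set_dropD)
    note this[THEN path_edges_sep]
    moreover have "hd (take (Suc i) p) = u" "last (take (Suc i) p) = ?a"
      "hd (drop (Suc i) p) = ?b" "last (drop (Suc i) p) = v"
      using p i' by (auto simp: is_path_def hd_drop_conv_nth take_Suc_conv_app_nth hd_append hd_conv_nth last_drop)
    ultimately have sep: "sep u ?a = set (take i (path_edges p))" "sep ?b v = set (drop (Suc i) (path_edges p))"
      by (simp_all add: path_edges_take path_edges_drop)
    have card: "card (sep u ?a) = i" "card (sep ?b v) = ?m - Suc i"
      using dis i unfolding sep by (auto simp: distinct_card)
    have notin: "e \<notin> sep u ?a" "e \<notin> sep ?b v"
      using dis(1) id_take_nth_drop[OF i(1)] i(2) unfolding sep
      by (metis disjoint_insert(1) distinct.simps(2) distinct_append list.simps(15))+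
    obtain x where "x \<in> e" and x: "\<forall>z\<in>V. e \<notin> sep x z \<longrightarrow> card (sep x z) < d"
      using e unfolding outer_edges_eq by auto
    \<comment> \<open>From \<open>?a\<close> the path back to \<open>u\<close> has \<open>i\<close>
      edges, from \<open>?b\<close> the path on to \<open>v\<close> has \<open>?m - Suc i\<close>,
      and both avoid \<open>e\<close>.\<close>
    then consider "x = ?a" | "x = ?b" using e_eq by auto
    then have "i < d \<or> ?m - Suc i < d"
      using x card notin assms sep_commute by cases auto
    then show "e \<in> (\<lambda>i. path_edges p ! i) ` ({..<d} \<union> {?m - d..<?m})" using i by auto
  qed
  then have "card (sep u v \<inter> outer_edges V E d) \<le> card ({..<d} \<union> {?m - d..<?m})"
    by (rule surj_card_le[rotated]) simp
  also have "\<dots> \<le> 2 * d" by (rule order.trans[OF card_Un_le]) simp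
  finally show ?thesis .
qed

section \<open>Optimal solutions for even and odd \<open>\<beta>\<close>\<close>

lemma outer_edges_subset: "outer_edges V E d \<subseteq> E"
  by (auto simp: outer_edges_def)

lemma optimal_even:
  assumes "even \<beta>"
  shows "optimal_contraction V E (\<lambda>_. 1) (\<lambda>x. x - real \<beta>) (outer_edges V E (\<beta> div 2))"
  unfolding optimal_contraction_def
proof (intro conjI allI impI)
  show "is_contraction V E (\<lambda>_. 1) (\<lambda>x. x - real \<beta>) (outer_edges V E (\<beta> div 2))"
    unfolding is_contraction_iff using outer_edges_subset card_sep_outer[of _ _ "\<beta> div 2"] assms by simp
  fix C assume C: "is_contraction V E (\<lambda>_. 1) (\<lambda>x. x - real \<beta>) C"
  then have "C \<subseteq> E" unfolding is_contraction_iff by auto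
  then show "contraction_value V E C \<le> contraction_value V E (outer_edges V E (\<beta> div 2))"
    using contraction_card_even[OF C assms] by (simp add: contraction_value_eq outer_edges_subset)
qed

text \<open>The extra edge adds at most one to each path, and
  \<open>2 * (\<beta> div 2) + 1 = \<beta>\<close> for odd \<open>\<beta>\<close>; the size meets
  the bound of \<open>contraction_card_odd\<close>.\<close>

lemma optimal_odd:
  assumes "odd \<beta>" "e \<in> E - outer_edges V E (\<beta> div 2)"
  shows "optimal_contraction V E (\<lambda>_. 1) (\<lambda>x. x - real \<beta>) (outer_edges V E (\<beta> div 2) \<union> {e})"
  unfolding optimal_contraction_def
proof (intro conjI allI impI)
  let ?L = "outer_edges V E (\<beta> div 2)"
  have sub: "?L \<union> {e} \<subseteq> E" using assms(2) outer_edges_subset by auto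
  have fin: "finite ?L" using outer_edges_subset finite_E finite_subset by metis
  have "card (sep u v \<inter> (?L \<union> {e})) \<le> \<beta>" if "u \<in> V" "v \<in> V" for u v
  proof -
    have "card (sep u v \<inter> (?L \<union> {e})) \<le> card (insert e (sep u v \<inter> ?L))"
      by (rule card_mono) auto
    also have "\<dots> \<le> Suc (card (sep u v \<inter> ?L))" by (simp add: card_insert_if)
    also have "\<dots> \<le> Suc (2 * (\<beta> div 2))" using card_sep_outer[OF that] by simp
    also have "\<dots> = \<beta>" using assms(1) by presburger
    finally show ?thesis .
  qed
  then show "is_contraction V E (\<lambda>_. 1) (\<lambda>x. x - real \<beta>) (?L \<union> {e})"
    unfolding is_contraction_iff using sub by simp
  fix C assume C: "is_contraction V E (\<lambda>_. 1) (\<lambda>x. x - real \<beta>) C"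
  then have "C \<subseteq> E" unfolding is_contraction_iff by auto
  moreover have "card (?L \<union> {e}) = Suc (card ?L)" using assms(2) fin by simp
  ultimately show "contraction_value V E C \<le> contraction_value V E (?L \<union> {e})"
    using contraction_card_odd[OF C assms(1)] sub by (simp add: contraction_value_eq)
qed


subsection \<open>Peeling\<close>

text \<open>\<open>known F v\<close> is what can be reached from \<open>v\<close> when the first edge must not be in \<open>F\<close>, the set of
  edges that have not been peeled off yet.\<close>

definition known :: "'a set set \<Rightarrow> 'a \<Rightarrow> 'a set" where
  "known F v = {x \<in> V. \<forall>e\<in>F. v \<in> e \<longrightarrow> e \<notin> sep v x}"

text \<open>Array 5 of the program holds this value for every end of a remaining edge.\<close>

definition known_height :: "'a set set \<Rightarrow> 'a \<Rightarrow> nat" where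
  "known_height F v = Max ((\<lambda>x. card (sep v x)) ` known F v)"

lemma height_E: "height E v e = Max ((\<lambda>x. card (sep v x)) ` side v e)"
proof -
  have "sep v x \<inter> E = sep v x" for x using sep_subset by auto
  then show ?thesis by (simp add: height_def)
qed

lemma known_E:
  assumes "v \<in> V"
  shows "known E v = {v}"
proof -
  have "x = v" if "x \<in> known E v" for x
  proof (rule ccontr)
    assume "x \<noteq> v"
    moreover have "x \<in> V" using that by (simp add: known_def)
    ultimately obtain w where "{v, w} \<in> sep v x" using sep_first_edge[of v x] assms by metis
    moreover from this have "{v, w} \<in> E" using sep_subset by blast
    ultimately show False using that by (auto simp: known_def)
  qed
  moreover have "v \<in> known E v" using assms by (simp add: known_def)
  ultimately show ?thesis by blast
qed

lemma known_height_E: "v \<in> V \<Longrightarrow> known_height E v = 0"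
  by (simp add: known_height_def known_E)

text \<open>Only \<open>e\<close> is still barred at \<open>v\<close>, so \<open>known F v\<close>
  is the whole side of \<open>v\<close>. Thus the height that decides about a last remaining edge
  can be read off.\<close>

lemma known_height_last:
  assumes "e \<in> F" "v \<in> e" "\<And>f. f \<in> F \<Longrightarrow> v \<in> f \<Longrightarrow> f = e"
  shows "known_height F v = height E v e"
proof -
  have "known F v = side v e" unfolding known_def side_def using assms by blast
  then show ?thesis by (simp add: known_height_def height_E)
qed

lemma known_height_other: "v \<notin> e \<Longrightarrow> known_height (F - {e}) v = known_height F v"
  unfolding known_height_def known_def by (rule arg_cong[where f = Max], rule image_cong) auto

text \<open>Peeling \<open>{x, y}\<close> opens to \<open>y\<close> exactly the side of
  \<open>x\<close>, at distances one larger than from \<open>x\<close>.\<close>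

lemma known_height_peel:
  assumes F: "F \<subseteq> E" and e: "{x, y} \<in> F"
  shows "known_height (F - {{x, y}}) y = max (known_height F y) (Suc (height E x {x, y}))"
proof -
  let ?e = "{x, y}"
  have E: "?e \<in> E" using F e by auto
  have V: "x \<in> V" "y \<in> V" using edge_subset[OF E] by auto
  have sep_y: "sep y z = insert ?e (sep x z)" "?e \<notin> sep x z" if "z \<in> side x ?e" for z
    using sep_bridge(1)[of y x y z] that E V by (auto simp: side_def insert_commute)
  have "known (F - {?e}) y = known F y \<union> side x ?e"
  proof (intro equalityI subsetI)
    fix z assume z: "z \<in> known (F - {?e}) y"
    then have "z \<in> V" by (auto simp: known_def)
    show "z \<in> known F y \<union> side x ?e"
    proof (cases "?e \<in> sep y z")
      case True
      then have "z \<in> side x ?e"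
        using sep_ends_iff[OF E \<open>z \<in> V\<close>] \<open>z \<in> V\<close> sep_commute by (auto simp: side_def)
      then show ?thesis by simp
    next
      case False
      then show ?thesis using z by (auto simp: known_def)
    qed
  next
    fix z assume "z \<in> known F y \<union> side x ?e"
    then show "z \<in> known (F - {?e}) y"
    proof
      assume z: "z \<in> side x ?e"
      \<comment> \<open>Otherwise the path from \<open>x\<close> to \<open>z\<close>, which avoids
        \<open>?e\<close>, would use \<open>f\<close> and pass through \<open>y\<close>.\<close>
      have "f \<notin> sep y z" if f: "f \<in> F" "y \<in> f" "f \<noteq> ?e" for f
      proof
        assume "f \<in> sep y z"
        then have "f \<in> sep x z" using sep_y[OF z] f by auto
        then have "?e \<notin> sep x y" using sep_passes[of f x z ?e y] sep_y[OF z] f E by auto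
        then show False using sep_edge[OF E] by simp
      qed
      then show ?thesis using z by (auto simp: known_def side_def)
    qed (auto simp: known_def)
  qed
  moreover have "known F y \<noteq> {}" "side x ?e \<noteq> {}"
    using V by (auto simp: known_def side_def)
  moreover have fin: "finite (known F y)"
    using finite_V by (rule finite_subset[rotated]) (auto simp: known_def)
  ultimately have "known_height (F - {?e}) y
      = max (known_height F y) (Max ((\<lambda>z. card (sep y z)) ` side x ?e))"
    unfolding known_height_def by (simp add: image_Un Max_Un)
  also have "(\<lambda>z. card (sep y z)) ` side x ?e = Suc ` (\<lambda>z. card (sep x z)) ` side x ?e"
    unfolding image_image by (rule image_cong) (simp_all add: sep_y)
  also have "Max (Suc ` (\<lambda>z. card (sep x z)) ` side x ?e) = Suc (height E x ?e)"
    unfolding height_E using \<open>side x ?e \<noteq> {}\<close>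
    by (intro mono_Max_commute[symmetric]) (auto simp: mono_def)
  finally show ?thesis .
qed

text \<open>A remaining edge of \<open>L(T, d)\<close> of minimal height would have all other edges at its end
  peeled off.\<close>

lemma peeling_complete:
  assumes F: "F \<subseteq> E"
    and stuck: "\<And>v e. e \<in> F \<Longrightarrow> v \<in> e \<Longrightarrow> (\<And>f. f \<in> F \<Longrightarrow> v \<in> f \<Longrightarrow> f = e) \<Longrightarrow> d \<le> height E v e"
  shows "F \<inter> outer_edges V E d = {}"
proof (rule ccontr)
  assume "F \<inter> outer_edges V E d \<noteq> {}"
  then have "\<exists>p. snd p \<in> F \<and> fst p \<in> snd p \<and> height E (fst p) (snd p) < d"
    unfolding outer_edges_height by auto
  then obtain p where p: "snd p \<in> F" "fst p \<in> snd p" "height E (fst p) (snd p) < d"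
    and least: "\<And>q. snd q \<in> F \<and> fst q \<in> snd q \<and> height E (fst q) (snd q) < d \<Longrightarrow>
      height E (fst p) (snd p) \<le> height E (fst q) (snd q)"
    using ex_has_least_nat[of "\<lambda>p. snd p \<in> F \<and> fst p \<in> snd p \<and> height E (fst p) (snd p) < d" _
        "\<lambda>p. height E (fst p) (snd p)"] by blast
  obtain v e where [simp]: "p = (v, e)" by (cases p)
  obtain f where f: "f \<in> F" "v \<in> f" "f \<noteq> e"
    using stuck[of e v] p by fastforce
  have fE: "f \<in> E" "e \<in> E" using f p F by auto
  obtain w where w: "f = {v, w}" "v \<in> V" using edge_end[OF fE(1) f(2)] by metis
  have wv: "{w, v} = f" using w by auto
  have "v \<notin> side w f" using side_compl[of v w] side_self[OF w(2), of f] fE w by auto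
  \<comment> \<open>Paths beyond \<open>f\<close> extend by \<open>f\<close> to paths from
    \<open>v\<close> that avoid \<open>e\<close>, so the height at \<open>w\<close> is smaller,
    against minimality.\<close>
  then have "Suc (height E w f) \<le> height E v e"
    using height_step(2)[of w v e v E] fE f p side_self[OF w(2), of e] unfolding wv by auto
  then show False using least[of "(w, f)"] f w p by auto
qed

text \<open>No path has more than \<open>card V - 1\<close> edges. This justifies the cap on
  \<open>d\<close> in the program.\<close>

lemma outer_edges_all:
  assumes "card V \<le> d"
  shows "outer_edges V E d = E"
proof -
  have "card (sep v x) < d" for v x
    using card_mono[OF finite_E sep_subset[of v x]] card_V assms by simp
  moreover have "\<exists>v. v \<in> e" if "e \<in> E" for e using that by (blast elim: edgeE)
  ultimately show ?thesis unfolding outer_edges_eq by blast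
qed

end

subsection \<open>A linear-time program\<close>

text \<open>All loop bodies used are loop-free, so a function can evaluate them. The value at
  \<open>Loop\<close> is a dummy, excluded by \<open>safe\<close>.\<close>

fun run :: "prog \<Rightarrow> state \<Rightarrow> state" where
  "run Nop s = s"
| "run (Assign x e) s = ((fst s)(x := expr_val e s), snd s)"
| "run (Store a i e) s = (fst s, (snd s)(a := (snd s a)(expr_val i s := expr_val e s)))"
| "run (Seq c d) s = run d (run c s)"
| "run (Cond b c d) s = (if test_val b s then run c s else run d s)"
| "run (Loop b c) s = s"

fun safe :: "nat \<Rightarrow> prog \<Rightarrow> state \<Rightarrow> bool" where
  "safe w Nop s \<longleftrightarrow> True"
| "safe w (Assign x e) s \<longleftrightarrow> expr_val e s \<le> w"
| "safe w (Store a i e) s \<longleftrightarrow> expr_val i s \<le> w \<and> expr_val e s \<le> w"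
| "safe w (Seq c d) s \<longleftrightarrow> safe w c s \<and> safe w d (run c s)"
| "safe w (Cond b c d) s \<longleftrightarrow> (if test_val b s then safe w c s else safe w d s)"
| "safe w (Loop b c) s \<longleftrightarrow> False"

text \<open>Both branches of a conditional are charged, so that the bound does not depend on the
  state.\<close>

fun cost :: "prog \<Rightarrow> nat" where
  "cost Nop = 1"
| "cost (Assign x e) = 1 + expr_cost e"
| "cost (Store a i e) = 1 + expr_cost i + expr_cost e"
| "cost (Seq c d) = cost c + cost d"
| "cost (Cond b c d) = test_cost b + cost c + cost d"
| "cost (Loop b c) = 0"

lemma exec_run: "safe w c s \<Longrightarrow> \<exists>t\<le>cost c. exec w c s t (run c s)"
proof (induction c arbitrary: s)
  case (Seq c d)
  then have "safe w c s" "safe w d (run c s)" by auto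
  from Seq.IH(1)[OF this(1)] Seq.IH(2)[OF this(2)]
  obtain t u where "t \<le> cost c" "exec w c s t (run c s)" "u \<le> cost d"
    "exec w d (run c s) u (run d (run c s))" by blast
  then show ?case by (intro exI[of _ "t + u"]) (auto intro: exec.Seq)
next
  case (Cond b c d)
  show ?case
  proof (cases "test_val b s")
    case True
    with Cond.IH(1)[of s] Cond.prems obtain t where "t \<le> cost c" "exec w c s t (run c s)" by auto
    with True show ?thesis by (intro exI[of _ "test_cost b + t"]) (auto intro: exec.CondTrue)
  next
    case False
    with Cond.IH(2)[of s] Cond.prems obtain t where "t \<le> cost d" "exec w d s t (run d s)" by auto
    with False show ?thesis by (intro exI[of _ "test_cost b + t"]) (auto intro: exec.CondFalse)
  qed
next
  case Nop
  show ?case using exec.Nop by (intro exI[of _ 1]) simp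
next
  case (Assign x e)
  then show ?case using exec.Assign by (intro exI[of _ "1 + expr_cost e"]) simp
next
  case (Store a i e)
  then show ?case using exec.Store by (intro exI[of _ "1 + expr_cost i + expr_cost e"]) simp
qed simp

text \<open>Total correctness with time bound \<open>T\<close>: existence of a run includes
  termination and that every stored value fits into a word.\<close>

definition ends_in :: "nat \<Rightarrow> prog \<Rightarrow> state \<Rightarrow> nat \<Rightarrow> (state \<Rightarrow> bool) \<Rightarrow> bool" where
  "ends_in w c s T Q \<longleftrightarrow> (\<exists>t\<le>T. \<exists>s'. exec w c s t s' \<and> Q s')"

lemma ends_in_run: "safe w c s \<Longrightarrow> cost c \<le> T \<Longrightarrow> Q (run c s) \<Longrightarrow> ends_in w c s T Q"
  unfolding ends_in_def using exec_run[of w c s] le_trans by blast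

lemma ends_in_mono:
  "ends_in w c s T Q \<Longrightarrow> (\<And>s'. Q s' \<Longrightarrow> R s') \<Longrightarrow> T \<le> U \<Longrightarrow> ends_in w c s U R"
  unfolding ends_in_def using le_trans by blast

lemma ends_in_Seq:
  assumes "ends_in w c s T Q" "\<And>s'. Q s' \<Longrightarrow> ends_in w d s' U R"
  shows "ends_in w (Seq c d) s (T + U) R"
  using assms unfolding ends_in_def by (meson add_mono exec.Seq)

text \<open>The number \<open>k\<close> is a variant carried by the invariant. It bounds the
  remaining rounds, and the last term pays for the failing test.\<close>

lemma ends_in_Loop:
  assumes "I k s"
    and step: "\<And>k s. I k s \<Longrightarrow> test_val b s \<Longrightarrow> safe w c s \<and> (\<exists>k'<k. I k' (run c s))"
    and post: "\<And>k s. I k s \<Longrightarrow> \<not> test_val b s \<Longrightarrow> Q s"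
    and T: "(test_cost b + cost c) * k + test_cost b \<le> T"
  shows "ends_in w (Loop b c) s T Q"
proof -
  have "\<exists>t\<le>(test_cost b + cost c) * k + test_cost b. \<exists>s'. exec w (Loop b c) s t s' \<and> Q s'"
    using assms(1)
  proof (induction k arbitrary: s rule: less_induct)
    case (less k)
    show ?case
    proof (cases "test_val b s")
      case True
      obtain k' where k': "k' < k" "I k' (run c s)" and s: "safe w c s"
        using step[OF less.prems True] by blast
      obtain t1 where t1: "t1 \<le> cost c" "exec w c s t1 (run c s)" using exec_run[OF s] by blast
      obtain t2 s' where t2: "exec w (Loop b c) (run c s) t2 s'" "Q s'"
        "t2 \<le> (test_cost b + cost c) * k' + test_cost b"
        using less.IH[OF k'] by blast
      have "test_cost b + t1 + t2 \<le> (test_cost b + cost c) * Suc k' + test_cost b"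
        using t1 t2 by simp
      also have "\<dots> \<le> (test_cost b + cost c) * k + test_cost b"
        using k' by (intro add_right_mono mult_left_mono) auto
      finally show ?thesis using exec.LoopTrue[OF True t1(2) t2(1)] t2(2) by blast
    next
      case False
      then have "exec w (Loop b c) s (test_cost b) s" "Q s"
        using less.prems post by (auto intro: exec.LoopFalse)
      then show ?thesis by (meson le_add2)
    qed
  qed
  then show ?thesis using T le_trans unfolding ends_in_def by blast
qed

text \<open>
  Register 2 holds \<open>min (\<beta> div 2) n\<close>. Arrays 3 and 4 hold, for every vertex, the number and the sum
  of the indices of its remaining edges, array 5 the length of a longest
  peeled path from it. After \<open>halve\<close> register 1 holds \<open>\<beta> mod 2\<close>, unless \<open>L(T, d) = E\<close>.
\<close>

definition halve :: prog where
  "halve = Loop (Conj (LessThan (Lit 1) (Reg 1)) (LessThan (Reg 2) (Reg 0)))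
     (Seq (Assign 1 (Sub (Reg 1) (Lit 2))) (Assign 2 (Add (Reg 2) (Lit 1))))"

definition count_body :: prog where
  "count_body =
     Seq (Assign 5 (Read 0 (Reg 3)))
    (Seq (Assign 6 (Read 1 (Reg 3)))
    (Seq (Store 3 (Reg 5) (Add (Read 3 (Reg 5)) (Lit 1)))
    (Seq (Store 4 (Reg 5) (Add (Read 4 (Reg 5)) (Reg 3)))
    (Seq (Store 3 (Reg 6) (Add (Read 3 (Reg 6)) (Lit 1)))
    (Seq (Store 4 (Reg 6) (Add (Read 4 (Reg 6)) (Reg 3)))
         (Assign 3 (Add (Reg 3) (Lit 1))))))))"

definition count :: prog where
  "count = Loop (LessThan (Add (Reg 3) (Lit 1)) (Reg 0)) count_body"

text \<open>Register 5 receives the only remaining edge at the current vertex, register 6 its other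
  end, obtained by subtraction from the sum of both ends. The loop goes on there, since no other
  vertex can have become peelable.\<close>

definition peel_body :: prog where
  "peel_body =
     Cond (Conj (Equal (Read 3 (Reg 4)) (Lit 1)) (LessThan (Read 5 (Reg 4)) (Reg 2)))
      (Seq (Assign 5 (Read 4 (Reg 4)))
      (Seq (Assign 6 (Sub (Add (Read 0 (Reg 5)) (Read 1 (Reg 5))) (Reg 4)))
      (Seq (Store 2 (Reg 5) (Lit 1))
      (Seq (Store 3 (Reg 4) (Lit 0))
      (Seq (Store 4 (Reg 4) (Lit 0))
      (Seq (Store 3 (Reg 6) (Sub (Read 3 (Reg 6)) (Lit 1)))
      (Seq (Store 4 (Reg 6) (Sub (Read 4 (Reg 6)) (Reg 5)))
      (Seq (Cond (LessThan (Read 5 (Reg 6)) (Add (Read 5 (Reg 4)) (Lit 1)))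
             (Store 5 (Reg 6) (Add (Read 5 (Reg 4)) (Lit 1))) Nop)
           (Assign 4 (Reg 6))))))))))
      (Seq (Assign 3 (Add (Reg 3) (Lit 1))) (Assign 4 (Reg 3)))"

definition peel :: prog where
  "peel = Loop (LessThan (Reg 3) (Reg 0)) peel_body"

text \<open>A tree has \<open>n - 1\<close> edges, so register 3 equals the length of the edge list
  when every edge is marked.\<close>

definition search :: prog where
  "search = Loop (Conj (LessThan (Add (Reg 3) (Lit 1)) (Reg 0)) (Equal (Read 2 (Reg 3)) (Lit 1)))
     (Assign 3 (Add (Reg 3) (Lit 1)))"

text \<open>A value above 1 in register 1 only occurs when \<open>d\<close> was capped, and then all
  edges are marked already.\<close>

definition mark :: prog where
  "mark = Cond (Conj (Equal (Reg 1) (Lit 1)) (LessThan (Add (Reg 3) (Lit 1)) (Reg 0)))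
     (Store 2 (Reg 3) (Lit 1)) Nop"

definition outer_prog :: prog where
  "outer_prog = Seq halve (Seq count (Seq (Assign 3 (Lit 0)) (Seq peel
     (Seq (Assign 3 (Lit 0)) (Seq search mark)))))"

section \<open>Encoded trees and incidence counts\<close>

locale tree_input =
  fixes n :: nat and es :: "(nat \<times> nat) list"
  assumes enc: "tree_encoding n es"
begin

sublocale tree "{..<n}" "edges_of es"
  using enc by unfold_locales (simp add: tree_encoding_def)

abbreviation "edge j \<equiv> edge_of (es ! j)"

definition indices :: "nat set" where "indices = {..<length es}"

lemma edges_of_eq: "edges_of es = edge ` indices"
proof -
  have "set es = (!) es ` indices" by (auto simp: indices_def set_conv_nth)
  then show ?thesis by (simp add: edges_of_def image_image)
qed

lemma inj_edge: "inj_on edge indices"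
proof (rule inj_onI)
  fix i j assume "i \<in> indices" "j \<in> indices" "edge i = edge j"
  moreover have "distinct (map edge_of es)" using enc by (simp add: tree_encoding_def)
  ultimately show "i = j" by (auto simp: indices_def distinct_conv_nth)
qed

lemma length_es: "Suc (length es) = n"
  using card_V card_image[OF inj_edge] unfolding edges_of_eq[symmetric] by (simp add: indices_def)

lemma edge_bounds:
  assumes "j \<in> indices"
  shows "fst (es ! j) < n" "snd (es ! j) < n" "fst (es ! j) \<noteq> snd (es ! j)"
proof -
  have "edge j \<in> edges_of es" using assms edges_of_eq by auto
  then obtain u v where "u < n" "v < n" "u \<noteq> v" "edge j = {u, v}" by (auto elim: edgeE)
  then show "fst (es ! j) < n" "snd (es ! j) < n" "fst (es ! j) \<noteq> snd (es ! j)"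
    by (auto simp: edge_of_def doubleton_eq_iff)
qed

definition incident :: "nat set \<Rightarrow> nat \<Rightarrow> nat set" where
  "incident J v = {j \<in> J. v \<in> edge j}"

definition counts :: "nat set \<Rightarrow> (nat \<Rightarrow> nat \<Rightarrow> nat) \<Rightarrow> bool" where
  "counts J a \<longleftrightarrow> (\<forall>v<n. a 3 v = card (incident J v) \<and> a 4 v = \<Sum>(incident J v))"

definition input :: "state \<Rightarrow> bool" where
  "input s \<longleftrightarrow> fst s 0 = n \<and>
    (\<forall>j\<in>indices. snd s 0 j = fst (es ! j) \<and> snd s 1 j = snd (es ! j))"

lemma finite_incident [simp]: "J \<subseteq> indices \<Longrightarrow> finite (incident J v)"
  by (rule finite_subset[of _ indices]) (auto simp: incident_def indices_def)

lemma card_incident_le: "J \<subseteq> indices \<Longrightarrow> card (incident J v) \<le> n"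
proof -
  assume "J \<subseteq> indices"
  then have "card (incident J v) \<le> card indices"
    by (intro card_mono) (auto simp: incident_def indices_def)
  then show ?thesis using length_es by (simp add: indices_def)
qed

text \<open>This crude bound on index sums is the source of the quadratic word bound.\<close>

lemma sum_incident_le: "J \<subseteq> indices \<Longrightarrow> \<Sum>(incident J v) \<le> n * n"
proof -
  assume J: "J \<subseteq> indices"
  then have "\<Sum>(incident J v) \<le> card (incident J v) * n"
    using length_es by (intro sum_bounded_above[of _ id n, simplified]) (auto simp: incident_def indices_def)
  also have "\<dots> \<le> n * n" using card_incident_le[OF J] by simp
  finally show ?thesis .
qed


lemma edge_in: "j \<in> indices \<Longrightarrow> edge j \<in> edges_of es"
  using edges_of_eq by auto

lemma edge_eq: "edge j = {fst (es ! j), snd (es ! j)}"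
  by (simp add: edge_of_def)

lemma counts_step:
  assumes "J \<subseteq> indices" "j \<in> indices" "j \<notin> J" and a: "counts J a"
    and a': "\<And>v. v < n \<Longrightarrow> a' 3 v = (if v \<in> edge j then a 3 v + 1 else a 3 v)"
    "\<And>v. v < n \<Longrightarrow> a' 4 v = (if v \<in> edge j then a 4 v + j else a 4 v)"
  shows "counts (insert j J) a'"
  unfolding counts_def
proof (intro allI impI)
  fix v assume v: "v < n"
  have "incident (insert j J) v = (if v \<in> edge j then insert j (incident J v) else incident J v)"
    by (auto simp: incident_def)
  moreover have "j \<notin> incident J v" using assms by (simp add: incident_def)
  ultimately show "a' 3 v = card (incident (insert j J) v) \<and> a' 4 v = \<Sum>(incident (insert j J) v)"
    using a a' v assms(1) by (simp add: counts_def)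
qed

lemma counts_remove:
  assumes "J \<subseteq> indices" "j \<in> J" and a: "counts J a"
    and a': "\<And>v. v < n \<Longrightarrow> a' 3 v = (if v \<in> edge j then a 3 v - 1 else a 3 v)"
    "\<And>v. v < n \<Longrightarrow> a' 4 v = (if v \<in> edge j then a 4 v - j else a 4 v)"
  shows "counts (J - {j}) a'"
  unfolding counts_def
proof (intro allI impI)
  fix v assume v: "v < n"
  have "incident (J - {j}) v = (if v \<in> edge j then incident J v - {j} else incident J v)"
    by (auto simp: incident_def)
  moreover have "v \<in> edge j \<Longrightarrow> j \<in> incident J v" using assms by (simp add: incident_def)
  ultimately show "a' 3 v = card (incident (J - {j}) v) \<and> a' 4 v = \<Sum>(incident (J - {j}) v)"
    using a a' v assms(1) by (simp add: counts_def sum_diff1_nat)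
qed

section \<open>Halving \<open>\<beta>\<close> and counting incident edges\<close>

text \<open>The variant is \<open>n\<close> minus register 2, so the number of rounds is bounded
  independently of \<open>\<beta>\<close>.\<close>

lemma ends_in_halve:
  assumes s: "input s" "fst s 1 = \<beta>" "fst s 2 = 0" "fst s 3 = 0" "fst s 4 = 0" and w: "n + \<beta> \<le> w"
  shows "ends_in w halve s (20 * n + 10) (\<lambda>s'. input s' \<and> snd s' = snd s \<and> fst s' 3 = 0 \<and> fst s' 4 = 0 \<and>
    fst s' 2 \<le> n \<and> fst s' 2 + fst s' 2 + fst s' 1 = \<beta> \<and> (fst s' 1 \<le> 1 \<or> fst s' 2 = n))"
proof -
  let ?I = "\<lambda>k s'. input s' \<and> snd s' = snd s \<and> fst s' 3 = 0 \<and> fst s' 4 = 0 \<and> fst s' 2 \<le> n \<and>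
    fst s' 2 + fst s' 2 + fst s' 1 = \<beta> \<and> k + fst s' 2 = n"
  show ?thesis
    unfolding halve_def
  proof (rule ends_in_Loop[where I = ?I and k = n])
    show "?I n s" using s by simp
  next
    fix k s' assume I: "?I k s'" and "test_val (Conj (LessThan (Lit 1) (Reg 1)) (LessThan (Reg 2) (Reg 0))) s'"
    then show "safe w (Seq (Assign 1 (Sub (Reg 1) (Lit 2))) (Assign 2 (Add (Reg 2) (Lit 1)))) s' \<and>
      (\<exists>k'<k. ?I k' (run (Seq (Assign 1 (Sub (Reg 1) (Lit 2))) (Assign 2 (Add (Reg 2) (Lit 1)))) s'))"
      using w I by (auto simp: input_def intro!: exI[of _ "k - 1"])
  next
    fix k s' assume I: "?I k s'" and "\<not> test_val (Conj (LessThan (Lit 1) (Reg 1)) (LessThan (Reg 2) (Reg 0))) s'"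
    then show "input s' \<and> snd s' = snd s \<and> fst s' 3 = 0 \<and> fst s' 4 = 0 \<and>
      fst s' 2 \<le> n \<and> fst s' 2 + fst s' 2 + fst s' 1 = \<beta> \<and> (fst s' 1 \<le> 1 \<or> fst s' 2 = n)"
      using I by (auto simp: input_def)
  qed simp
qed

lemma ends_in_count:
  assumes s: "input s" "fst s 3 = 0" "fst s 4 = 0" "fst s 2 = d" "fst s 1 = r"
    and zero: "\<And>a i. 2 \<le> a \<Longrightarrow> snd s a i = 0" and w: "n + n * n \<le> w"
  shows "ends_in w count s (50 * n + 5) (\<lambda>s'. input s' \<and> fst s' 1 = r \<and> fst s' 2 = d \<and> fst s' 4 = 0 \<and>
    (\<forall>i. snd s' 2 i = 0 \<and> snd s' 5 i = 0) \<and> counts indices (snd s'))"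
proof -
  let ?I = "\<lambda>k s'. input s' \<and> fst s' 1 = r \<and> fst s' 2 = d \<and> fst s' 4 = 0 \<and>
    (\<forall>i. snd s' 2 i = 0 \<and> snd s' 5 i = 0) \<and> fst s' 3 < n \<and> k + fst s' 3 = n \<and> counts {..<fst s' 3} (snd s')"
  show ?thesis
    unfolding count_def
  proof (rule ends_in_Loop[where I = ?I and k = n])
    show "?I n s" using s zero length_es by (auto simp: counts_def incident_def)
  next
    fix k s' assume I: "?I k s'" and b: "test_val (LessThan (Add (Reg 3) (Lit 1)) (Reg 0)) s'"
    obtain g a where [simp]: "s' = (g, a)" by (cases s')
    let ?i = "g 3"
    have i: "Suc ?i < n" "?i \<in> indices" "{..<?i} \<subseteq> indices" "{..<Suc ?i} \<subseteq> indices" "insert ?i {..<?i} = {..<Suc ?i}"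
      using I b length_es by (auto simp: input_def indices_def)
    have in1: "a 0 ?i = fst (es ! ?i)" "a (Suc 0) ?i = snd (es ! ?i)" "g 0 = n" using I i by (auto simp: input_def)
    note eb = edge_bounds[OF i(2)]
    let ?s = "run count_body s'"
    have run: "fst ?s = g(5 := fst (es ! ?i), 6 := snd (es ! ?i), 3 := Suc ?i)"
       "snd ?s 0 = a 0" "snd ?s (Suc 0) = a (Suc 0)" "snd ?s 2 = a 2" "snd ?s 5 = a 5"
       "snd ?s 3 v = (if v \<in> edge ?i then a 3 v + 1 else a 3 v)"
       "snd ?s 4 v = (if v \<in> edge ?i then a 4 v + ?i else a 4 v)" for v
      using eb in1 by (auto simp: count_body_def edge_eq)
    have c: "counts {..<?i} a" using I by simp
    have c': "counts {..<Suc ?i} (snd ?s)"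
      using counts_step[OF i(3,2) _ c, of "snd ?s"] run i(5) by simp
    have le: "a 3 v \<le> n" "a 4 v \<le> n * n" "snd ?s 3 v \<le> n" "snd ?s 4 v \<le> n * n" if "v < n" for v
      using c c' that card_incident_le[OF i(3)] sum_incident_le[OF i(3)]
        card_incident_le[OF i(4)] sum_incident_le[OF i(4)] by (simp_all add: counts_def)
    \<comment> \<open>The increased entries are themselves counts and sums for the next set of
      edges, hence bounded, so no store overflows.\<close>
    have le': "a 3 v + 1 \<le> n" "a 4 v + ?i \<le> n * n" if "v \<in> edge ?i" for v
      using that le[of v] run(6,7)[of v] eb by (auto simp: edge_eq)
    have "safe w count_body s'"
      using le'[of "fst (es ! ?i)"] le'[of "snd (es ! ?i)"] eb in1 i(1) w by (auto simp: count_body_def edge_eq)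
    moreover have "?I (k - 1) ?s"
      using I c' i(1) run by (auto simp: input_def)
    moreover have "k - 1 < k" using I by auto
    ultimately show "safe w count_body s' \<and> (\<exists>k'<k. ?I k' (run count_body s'))" by blast
  next
    fix k s' assume I: "?I k s'" and "\<not> test_val (LessThan (Add (Reg 3) (Lit 1)) (Reg 0)) s'"
    \<comment> \<open>The loop leaves with register 3 equal to \<open>n - 1\<close>, the number of
      edges.\<close>
    then have "{..<fst s' 3} = indices" using length_es I by (auto simp: input_def indices_def)
    then show "input s' \<and> fst s' 1 = r \<and> fst s' 2 = d \<and> fst s' 4 = 0 \<and>
      (\<forall>i. snd s' 2 i = 0 \<and> snd s' 5 i = 0) \<and> counts indices (snd s')" using I by simp
  qed (simp add: count_body_def)
qed


text \<open>\<open>J\<close> holds the indices of the remaining edges; register 3 is the next vertex to start from and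
  register 4 the current vertex.\<close>

definition peel_inv :: "nat \<Rightarrow> nat \<Rightarrow> nat set \<Rightarrow> state \<Rightarrow> bool" where
  "peel_inv d r J s \<longleftrightarrow> J \<subseteq> indices \<and> input s \<and> fst s 1 = r \<and> fst s 2 = d \<and>
    counts J (snd s) \<and>
    (\<forall>j\<in>J. \<forall>v\<in>edge j. snd s 5 v = known_height (edge ` J) v) \<and>
    (\<forall>j\<in>indices. snd s 2 j = (if j \<in> J then 0 else 1)) \<and>
    edges_of es - edge ` J \<subseteq> outer_edges {..<n} (edges_of es) d \<and>
    fst s 3 \<le> n \<and> (fst s 4 < n \<longleftrightarrow> fst s 3 < n) \<and>
    (\<forall>v<n. v \<le> fst s 3 \<longrightarrow> v \<noteq> fst s 4 \<longrightarrow> \<not> (snd s 3 v = 1 \<and> snd s 5 v < d))"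

lemma peel_invD:
  assumes "peel_inv d r J s"
  shows "J \<subseteq> indices" "input s" "fst s 1 = r" "fst s 2 = d" "counts J (snd s)"
    and "j \<in> J \<Longrightarrow> v \<in> edge j \<Longrightarrow> snd s 5 v = known_height (edge ` J) v"
    and "j \<in> indices \<Longrightarrow> snd s 2 j = (if j \<in> J then 0 else 1)"
    and "edges_of es - edge ` J \<subseteq> outer_edges {..<n} (edges_of es) d"
    and "fst s 3 \<le> n" "fst s 4 < n \<longleftrightarrow> fst s 3 < n"
    and "v < n \<Longrightarrow> v \<le> fst s 3 \<Longrightarrow> v \<noteq> fst s 4 \<Longrightarrow> \<not> (snd s 3 v = 1 \<and> snd s 5 v < d)"
  using assms unfolding peel_inv_def by blast+

lemma inputD:
  assumes "input s"
  shows "fst s 0 = n" "j \<in> indices \<Longrightarrow> snd s 0 j = fst (es ! j)" "j \<in> indices \<Longrightarrow> snd s 1 j = snd (es ! j)"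
  using assms unfolding input_def by blast+

section \<open>Correctness of the peeling loop\<close>

text \<open>A sum over a single index is that index.\<close>

lemma single_incident:
  assumes "J \<subseteq> indices" "counts J a" "v < n" "a 3 v = 1"
  shows "a 4 v \<in> J" "v \<in> edge (a 4 v)" "\<And>j. j \<in> J \<Longrightarrow> v \<in> edge j \<Longrightarrow> j = a 4 v"
proof -
  have "card (incident J v) = 1" "a 4 v = \<Sum>(incident J v)" using assms by (auto simp: counts_def)
  then obtain j where "incident J v = {j}" "a 4 v = j" by (auto simp: card_1_singleton_iff)
  then have *: "incident J v = {a 4 v}" by simp
  then have "a 4 v \<in> incident J v" by simp
  then show "a 4 v \<in> J" "v \<in> edge (a 4 v)" by (simp_all add: incident_def)
  fix j assume "j \<in> J" "v \<in> edge j"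
  then have "j \<in> incident J v" by (simp add: incident_def)
  then show "j = a 4 v" using * by simp
qed

text \<open>Only the other end of the peeled edge can become peelable. It is made the current
  vertex, which the last clause of \<open>peel_inv\<close> exempts.\<close>

lemma peel_inv_step:
  assumes inv: "peel_inv d r J s" and lt: "fst s 3 < n"
    and act: "snd s 3 (fst s 4) = 1" "snd s 5 (fst s 4) < d"
    and d: "d \<le> n" and w: "n + n * n \<le> w"
  shows "safe w peel_body s \<and> peel_inv d r (J - {snd s 4 (fst s 4)}) (run peel_body s) \<and>
    fst (run peel_body s) 3 = fst s 3 \<and> snd s 4 (fst s 4) \<in> J"
proof -
  obtain g a where s: "s = (g, a)" by (cases s)
  let ?x = "g 4" and ?j = "a 4 (g 4)"
  let ?y = "fst (es ! ?j) + snd (es ! ?j) - ?x"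
  let ?e = "edge ?j" and ?F = "edge ` J" and ?J = "J - {?j}"
  note D = peel_invD[OF inv[unfolded s], unfolded fst_conv snd_conv]
  note inp = inputD[OF D(2), unfolded fst_conv snd_conv]
  have regs: "g 1 = r" "g 2 = d" "g 3 < n" and xn: "?x < n"
    using D(3,4,10) lt by (simp_all add: s)
  note J = D(1) and c = D(5) and ht = D(6) and out = D(7) and sound = D(8) and stuck = D(11)
  have x1: "a 3 ?x = 1" "a 5 ?x < d" using act by (auto simp: s)
  note single = single_incident[OF J c xn x1(1)]
  have jJ: "?j \<in> J" "?j \<in> indices" using single(1) J by blast+
  have e: "?e = {?x, ?y}" and xy: "?x \<noteq> ?y" and yn: "?y < n"
    using single(2) edge_bounds[OF jJ(2)] by (auto simp: edge_eq)
  let ?h = "if a 5 ?y < a 5 ?x + 1 then a 5 ?x + 1 else a 5 ?y"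
  let ?s = "run peel_body s"
  have a01: "a 0 ?j + a 1 ?j - ?x = ?y" using inp jJ by simp
  have run: "fst ?s = g(5 := ?j, 6 := ?y, 4 := ?y)"
     "snd ?s = a(2 := (a 2)(?j := 1), 3 := (a 3)(?x := 0, ?y := a 3 ?y - 1),
        4 := (a 4)(?x := 0, ?y := a 4 ?y - ?j), 5 := (a 5)(?y := ?h))"
    using x1 xy inp(2,3) jJ regs by (auto simp: s peel_body_def fun_eq_iff)
  have c': "counts ?J (snd ?s)"
    by (rule counts_remove[OF J jJ(1) c]) (use xy e x1 in \<open>auto simp: run\<close>)
  have F': "edge ` ?J = ?F - {?e}"
    using inj_on_image_set_diff[OF inj_edge, of J "{?j}"] J jJ by auto
  have FE: "?F \<subseteq> edges_of es" "?e \<in> ?F" "?e \<in> edges_of es" using J edges_of_eq jJ by auto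
  \<comment> \<open>\<open>?e\<close> is the last remaining edge at \<open>?x\<close>, so the stored
    value is its height.\<close>
  have hx: "a 5 ?x = height (edges_of es) ?x ?e"
  proof -
    have "known_height ?F ?x = height (edges_of es) ?x ?e"
    proof (rule known_height_last[OF FE(2) single(2)])
      fix f assume "f \<in> ?F" "?x \<in> f"
      then obtain i where "i \<in> J" "f = edge i" "?x \<in> edge i" by blast
      then show "f = ?e" using single(3)[of i] by simp
    qed
    then show ?thesis using ht[OF jJ(1) single(2)] by simp
  qed
  have safe: "safe w peel_body s"
  proof -
    have "?j < n" using jJ length_es by (auto simp: indices_def)
    moreover have "a 3 ?y \<le> n" "a 4 ?y \<le> n * n"
      using c yn card_incident_le[OF J] sum_incident_le[OF J] by (auto simp: counts_def)
    ultimately show ?thesis using x1 xy inp(2,3) jJ regs d w yn xn a01 by (auto simp: s peel_body_def)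
  qed
  have "peel_inv d r ?J ?s"
    unfolding peel_inv_def
  proof (intro conjI)
    show "?J \<subseteq> indices" using J by auto
    show "input ?s" using inp unfolding input_def run by auto
    show "fst ?s 1 = r" "fst ?s 2 = d" "fst ?s 3 \<le> n" "fst ?s 4 < n \<longleftrightarrow> fst ?s 3 < n"
      using regs yn unfolding run by auto
    show "counts ?J (snd ?s)" by (rule c')
    \<comment> \<open>The entry of \<open>?x\<close> may become outdated, since no remaining edge
      contains \<open>?x\<close>. The entry of \<open>?y\<close> is raised as in
      \<open>known_height_peel\<close>.\<close>
    show "\<forall>j\<in>?J. \<forall>v\<in>edge j. snd ?s 5 v = known_height (edge ` ?J) v"
    proof (intro ballI)
      fix j v assume j: "j \<in> ?J" "v \<in> edge j"
      then have vx: "v \<noteq> ?x" using single(3)[of j] by auto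
      show "snd ?s 5 v = known_height (edge ` ?J) v"
      proof (cases "v = ?y")
        case True
        have "a 5 ?y = known_height ?F ?y" using ht[of j ?y] j True by auto
        moreover have "known_height (?F - {?e}) ?y = max (known_height ?F ?y) (Suc (height (edges_of es) ?x ?e))"
          using known_height_peel[of ?F ?x ?y] FE unfolding e by auto
        ultimately show ?thesis using hx unfolding True run F' by (simp add: max_def)
      next
        case False
        then have "v \<notin> ?e" using vx e by auto
        then have "known_height (?F - {?e}) v = known_height ?F v" by (rule known_height_other)
        then show ?thesis using ht[of j v] j False unfolding run F' by simp
      qed
    qed
    show "\<forall>j\<in>indices. snd ?s 2 j = (if j \<in> ?J then 0 else 1)"
      using out unfolding run by auto
    have "?e \<in> outer_edges {..<n} (edges_of es) d"
      unfolding outer_edges_height using FE single(2) hx x1(2) by auto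
    then show "edges_of es - edge ` ?J \<subseteq> outer_edges {..<n} (edges_of es) d"
      using sound unfolding F' by auto
    show "\<forall>v<n. v \<le> fst ?s 3 \<longrightarrow> v \<noteq> fst ?s 4 \<longrightarrow> \<not> (snd ?s 3 v = 1 \<and> snd ?s 5 v < d)"
      using stuck unfolding run by auto
  qed
  then show ?thesis using safe jJ run(1) by (simp add: s)
qed

text \<open>The vertex exempted so far is now known to be stuck, and the exemption moves to the next
  starting vertex. After the last one both registers become \<open>n\<close> and the loop
  ends.\<close>

lemma peel_inv_skip:
  assumes inv: "peel_inv d r J s" and lt: "fst s 3 < n"
    and inact: "\<not> (snd s 3 (fst s 4) = 1 \<and> snd s 5 (fst s 4) < d)" and w: "n \<le> w"
  shows "safe w peel_body s \<and> peel_inv d r J (run peel_body s) \<and> fst (run peel_body s) 3 = Suc (fst s 3)"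
proof -
  have d: "fst s 2 = d" using inv by (simp add: peel_inv_def)
  have b: "\<not> test_val (Conj (Equal (Read 3 (Reg 4)) (Lit 1)) (LessThan (Read 5 (Reg 4)) (Reg 2))) s"
    using inact d by auto
  have run: "run peel_body s = ((fst s)(3 := Suc (fst s 3), 4 := Suc (fst s 3)), snd s)"
    using b by (auto simp: peel_body_def)
  have safe: "safe w peel_body s" using b lt w by (auto simp: peel_body_def)
  have stuck: "\<not> (snd s 3 v = 1 \<and> snd s 5 v < d)" if "v < n" "v \<le> fst s 3" for v
    using that inv inact unfolding peel_inv_def by (cases "v = fst s 4") auto
  have "peel_inv d r J (run peel_body s)"
    using inv lt stuck unfolding run peel_inv_def input_def by (auto simp: le_Suc_eq)
  then show ?thesis using safe by (simp add: run)
qed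

text \<open>At the end no vertex is exempt, so by \<open>peeling_complete\<close> no outer edge
  remains; the peeled edges are outer by the invariant.\<close>

lemma peel_inv_end:
  assumes inv: "peel_inv d r J s" and lt: "\<not> fst s 3 < n"
  shows "outer_edges {..<n} (edges_of es) d = edges_of es - edge ` J"
proof -
  let ?F = "edge ` J"
  note D = peel_invD[OF inv]
  note J = D(1) and c = D(5) and ht = D(6) and sound = D(8) and st = D(9,10) and stuck = D(11)
  have "?F \<inter> outer_edges {..<n} (edges_of es) d = {}"
  proof (rule peeling_complete)
    show FE: "?F \<subseteq> edges_of es" using J edges_of_eq by auto
    fix v e assume e: "e \<in> ?F" "v \<in> e" and only: "\<And>f. f \<in> ?F \<Longrightarrow> v \<in> f \<Longrightarrow> f = e"
    from e(1) obtain j where j: "j \<in> J" "e = edge j" by blast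
    have "e \<in> edges_of es" using e(1) FE by auto
    then have v: "v < n" using edge_subset[of e] e(2) by auto
    have "incident J v = {j}"
    proof -
      have "i = j" if "i \<in> J" "v \<in> edge i" for i
      proof (rule inj_onD[OF inj_edge])
        show "edge i = edge j" using only[of "edge i"] that j by blast
      qed (use that j J in auto)
      moreover have "j \<in> incident J v" using j e(2) by (simp add: incident_def)
      ultimately show ?thesis unfolding incident_def by blast
    qed
    then have "snd s 3 v = 1" using c v by (simp add: counts_def)
    moreover have "snd s 5 v = height (edges_of es) v e"
      using known_height_last[OF e only] ht[of j v] j e by simp
    ultimately show "d \<le> height (edges_of es) v e" using st stuck[of v] lt v by force
  qed
  then show ?thesis using sound outer_edges_subset by blast
qed


text \<open>Each round either removes an edge or advances the starting vertex, so the number of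
  vertices not yet started from plus the number of remaining edges is a variant.\<close>

lemma ends_in_peel:
  assumes s: "input s" "fst s 1 = r" "fst s 2 = d" "fst s 3 = 0" "fst s 4 = 0"
    and arr: "\<And>i. snd s 2 i = 0" "\<And>i. snd s 5 i = 0" "counts indices (snd s)"
    and d: "d \<le> n" and w: "n + n * n \<le> w"
  shows "ends_in w peel s (200 * n + 3) (\<lambda>s'. input s' \<and> fst s' 1 = r \<and>
    (\<exists>J\<subseteq>indices. outer_edges {..<n} (edges_of es) d = edges_of es - edge ` J \<and>
      (\<forall>j\<in>indices. snd s' 2 j = (if j \<in> J then 0 else 1))))"
proof -
  let ?I = "\<lambda>k s'. \<exists>J. peel_inv d r J s' \<and> k = (n - fst s' 3) + card J"
  have n: "0 < n" using length_es by auto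
  have init: "peel_inv d r indices s"
    unfolding peel_inv_def
  proof (intro conjI)
    show "\<forall>j\<in>indices. \<forall>v\<in>edge j. snd s 5 v = known_height (edge ` indices) v"
      using arr(2) known_height_E edge_subset edge_in unfolding edges_of_eq[symmetric] by (metis subsetD)
    show "edges_of es - edge ` indices \<subseteq> outer_edges {..<n} (edges_of es) d"
      using edges_of_eq by auto
  qed (use s arr n in auto)
  have card: "card indices \<le> n" using length_es by (simp add: indices_def)
  show ?thesis
    unfolding peel_def
  proof (rule ends_in_Loop[where I = ?I and k = "n + card indices"])
    show "?I (n + card indices) s" using init s by auto
  next
    fix k s' assume "?I k s'" and b: "test_val (LessThan (Reg 3) (Reg 0)) s'"
    then obtain J where J: "peel_inv d r J s'" "k = (n - fst s' 3) + card J" by blast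
    have "input s'" using peel_invD[OF J(1)] by blast
    then have lt: "fst s' 3 < n" using b by (simp add: input_def)
    show "safe w peel_body s' \<and> (\<exists>k'<k. ?I k' (run peel_body s'))"
    proof (cases "snd s' 3 (fst s' 4) = 1 \<and> snd s' 5 (fst s' 4) < d")
      case True
      let ?j = "snd s' 4 (fst s' 4)"
      have *: "safe w peel_body s'" "peel_inv d r (J - {?j}) (run peel_body s')"
        "fst (run peel_body s') 3 = fst s' 3" "?j \<in> J"
        using peel_inv_step[OF J(1) lt _ _ d w] True by blast+
      have "finite J" using peel_invD(1)[OF J(1)] finite_subset by (auto simp: indices_def)
      then have "card (J - {?j}) < card J" using *(4) by (rule card_Diff1_less)
      then have "(n - fst (run peel_body s') 3) + card (J - {?j}) < k" using *(3) J(2) by simp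
      then show ?thesis using *(1,2) by blast
    next
      case False
      have *: "safe w peel_body s'" "peel_inv d r J (run peel_body s')"
        "fst (run peel_body s') 3 = Suc (fst s' 3)"
        using peel_inv_skip[OF J(1) lt False, of w] w by simp_all
      have "(n - fst (run peel_body s') 3) + card J < k" using *(3) J(2) lt by simp
      then show ?thesis using *(1,2) by blast
    qed
  next
    fix k s' assume "?I k s'" and b: "\<not> test_val (LessThan (Reg 3) (Reg 0)) s'"
    then obtain J where J: "peel_inv d r J s'" by blast
    note D = peel_invD[OF J]
    have "\<not> fst s' 3 < n" using b D(2) by (simp add: input_def)
    note end_eq = peel_inv_end[OF J this]
    show "input s' \<and> fst s' 1 = r \<and>
      (\<exists>J\<subseteq>indices. outer_edges {..<n} (edges_of es) d = edges_of es - edge ` J \<and>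
        (\<forall>j\<in>indices. snd s' 2 j = (if j \<in> J then 0 else 1)))"
      using D(1,2,3,7) end_eq by blast
  next
    \<comment> \<open>There are at most 100 steps per round and \<open>2 * n\<close> rounds; the
      final 3 pays for the failing test.\<close>
    have "test_cost (LessThan (Reg 3) (Reg 0)) + cost peel_body \<le> 100"
      by (simp add: peel_body_def)
    then have "(test_cost (LessThan (Reg 3) (Reg 0)) + cost peel_body) * (n + card indices) \<le> 100 * (n + n)"
      using card by (intro mult_mono) auto
    then show "(test_cost (LessThan (Reg 3) (Reg 0)) + cost peel_body) * (n + card indices) +
      test_cost (LessThan (Reg 3) (Reg 0)) \<le> 200 * n + 3"
      by simp
  qed
qed

section \<open>Search for the additional edge and the complete program\<close>

lemma ends_in_search:
  assumes s: "input s" "fst s 1 = r" "fst s 3 = 0" and w: "n \<le> w"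
  shows "ends_in w search s (20 * n + 10) (\<lambda>s'. fst s' 0 = n \<and> fst s' 1 = r \<and> snd s' = snd s \<and>
    (\<forall>j<fst s' 3. snd s 2 j = 1) \<and> (Suc (fst s' 3) < n \<longrightarrow> snd s 2 (fst s' 3) \<noteq> 1) \<and> fst s' 3 < n)"
proof -
  let ?I = "\<lambda>k s'. fst s' 0 = n \<and> fst s' 1 = r \<and> snd s' = snd s \<and>
    (\<forall>j<fst s' 3. snd s 2 j = 1) \<and> fst s' 3 < n \<and> k + fst s' 3 = n"
  have n: "0 < n" using length_es by auto
  show ?thesis
    unfolding search_def
  proof (rule ends_in_Loop[where I = ?I and k = n])
    show "?I n s" using s n by (simp add: input_def)
  next
    fix k s' assume I: "?I k s'"
      and b: "test_val (Conj (LessThan (Add (Reg 3) (Lit 1)) (Reg 0)) (Equal (Read 2 (Reg 3)) (Lit 1))) s'"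
    have "?I (k - 1) (run (Assign 3 (Add (Reg 3) (Lit 1))) s')" using I b by (auto simp: less_Suc_eq)
    moreover have "k - 1 < k" using I by auto
    moreover have "safe w (Assign 3 (Add (Reg 3) (Lit 1))) s'" using I b w by auto
    ultimately show "safe w (Assign 3 (Add (Reg 3) (Lit 1))) s' \<and>
      (\<exists>k'<k. ?I k' (run (Assign 3 (Add (Reg 3) (Lit 1))) s'))" by blast
  qed auto
qed

lemma output_eq: "output_edges es s = edge ` {j \<in> indices. snd s 2 j = 1}"
  by (auto simp: output_edges_def indices_def)

lemma ends_in_outer_prog:
  fixes \<beta> :: nat
  defines "L \<equiv> outer_edges {..<n} (edges_of es) (\<beta> div 2)"
  assumes w: "n + \<beta> + n * n \<le> w"
  shows "ends_in w outer_prog (input_state n \<beta> es) (1000 * n) (\<lambda>s.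
    (even \<beta> \<longrightarrow> output_edges es s = L) \<and>
    (odd \<beta> \<and> L \<noteq> edges_of es \<longrightarrow> (\<exists>e \<in> edges_of es - L. output_edges es s = L \<union> {e})) \<and>
    (odd \<beta> \<and> L = edges_of es \<longrightarrow> output_edges es s = L))" (is "ends_in w _ _ _ ?post")
proof -
  let ?E = "edges_of es"
  have n: "0 < n" using length_es by auto
  have in0: "input (input_state n \<beta> es)"
    by (auto simp: input_def input_state_def indices_def)
  \<comment> \<open>\<open>?Q1\<close> to \<open>?Q6\<close> are the assertions between consecutive
    parts of the program. In them \<open>?J\<close> says that exactly the edges of \<open>L\<close>
    are marked.\<close>
  let ?Q1 = "\<lambda>s'. input s' \<and> snd s' = snd (input_state n \<beta> es) \<and> fst s' 3 = 0 \<and> fst s' 4 = 0 \<and>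
    fst s' 2 \<le> n \<and> fst s' 2 + fst s' 2 + fst s' 1 = \<beta> \<and> (fst s' 1 \<le> 1 \<or> fst s' 2 = n)"
  let ?reg = "\<lambda>r d. d \<le> n \<and> d + d + r = \<beta> \<and> (r \<le> 1 \<or> d = n)"
  \<comment> \<open>If the halving ran to the end, \<open>d\<close> and \<open>r\<close> are
    quotient and remainder of \<open>\<beta>\<close> by 2. Otherwise \<open>d = n\<close>, and both
    \<open>d\<close> and \<open>\<beta> div 2\<close> are large enough for the outer edges to be all
    of \<open>?E\<close>.\<close>
  have L: "outer_edges {..<n} ?E d = L \<and> (r = 1 \<longrightarrow> odd \<beta>) \<and> (odd \<beta> \<and> r \<noteq> 1 \<longrightarrow> L = ?E)"
    if "?reg r d" for r d
  proof (cases "r \<le> 1")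
    case True
    then have "d = \<beta> div 2" "odd \<beta> \<longleftrightarrow> r = 1" using that by presburger+
    then show ?thesis by (simp add: L_def)
  next
    case False
    then have "n \<le> d" "n \<le> \<beta> div 2" using that by auto
    then show ?thesis using False outer_edges_all[of d] outer_edges_all[of "\<beta> div 2"] by (simp add: L_def)
  qed
  let ?J = "\<lambda>J s. J \<subseteq> indices \<and> L = ?E - edge ` J \<and> (\<forall>j\<in>indices. snd s 2 j = (if j \<in> J then 0 else 1))"
  let ?Q2 = "\<lambda>s. input s \<and> ?reg (fst s 1) (fst s 2) \<and> fst s 4 = 0 \<and>
    (\<forall>i. snd s 2 i = 0 \<and> snd s 5 i = 0) \<and> counts indices (snd s)"
  let ?Q3 = "\<lambda>s. ?Q2 s \<and> fst s 3 = 0"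
  let ?par = "\<lambda>r. (r = 1 \<longrightarrow> odd \<beta>) \<and> (odd \<beta> \<and> r \<noteq> 1 \<longrightarrow> L = ?E)"
  let ?Q4 = "\<lambda>s. input s \<and> ?par (fst s 1) \<and> (\<exists>J. ?J J s)"
  let ?Q5 = "\<lambda>s. ?Q4 s \<and> fst s 3 = 0"
  let ?Q6 = "\<lambda>s. fst s 0 = n \<and> ?par (fst s 1) \<and> (\<exists>J. ?J J s) \<and>
    (\<forall>j<fst s 3. snd s 2 j = 1) \<and> (Suc (fst s 3) < n \<longrightarrow> snd s 2 (fst s 3) \<noteq> 1) \<and> fst s 3 < n"
  have 1: "ends_in w halve (input_state n \<beta> es) (20 * n + 10) ?Q1"
    using w by (intro ends_in_halve in0) (simp_all add: input_state_def)
  have 2: "ends_in w count s (50 * n + 5) ?Q2" if "?Q1 s" for s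
  proof -
    have zero: "snd s a i = 0" if "2 \<le> a" for a i
      using \<open>?Q1 s\<close> that by (simp add: input_state_def)
    have "ends_in w count s (50 * n + 5) (\<lambda>s'. input s' \<and> fst s' 1 = fst s 1 \<and> fst s' 2 = fst s 2 \<and>
      fst s' 4 = 0 \<and> (\<forall>i. snd s' 2 i = 0 \<and> snd s' 5 i = 0) \<and> counts indices (snd s'))"
      using that w zero by (intro ends_in_count) auto
    then show ?thesis by (rule ends_in_mono) (use that in auto)
  qed
  have 3: "ends_in w (Assign 3 (Lit 0)) s 2 ?Q3" if "?Q2 s" for s
    using that by (intro ends_in_run) (auto simp: input_def)
  have 4: "ends_in w peel s (200 * n + 3) ?Q4" if "?Q3 s" for s
  proof -
    have "ends_in w peel s (200 * n + 3) (\<lambda>s'. input s' \<and> fst s' 1 = fst s 1 \<and>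
      (\<exists>J\<subseteq>indices. outer_edges {..<n} ?E (fst s 2) = ?E - edge ` J \<and>
        (\<forall>j\<in>indices. snd s' 2 j = (if j \<in> J then 0 else 1))))"
      using that w by (intro ends_in_peel) auto
    moreover have "outer_edges {..<n} ?E (fst s 2) = L \<and> ?par (fst s 1)" using L that by blast
    ultimately show ?thesis by (elim ends_in_mono) auto
  qed
  have 5: "ends_in w (Assign 3 (Lit 0)) s 2 ?Q5" if "?Q4 s" for s
    using that by (intro ends_in_run) (auto simp: input_def)
  have 6: "ends_in w search s (20 * n + 10) ?Q6" if "?Q5 s" for s
  proof -
    have "ends_in w search s (20 * n + 10) (\<lambda>s'. fst s' 0 = n \<and> fst s' 1 = fst s 1 \<and> snd s' = snd s \<and>
      (\<forall>j<fst s' 3. snd s 2 j = 1) \<and> (Suc (fst s' 3) < n \<longrightarrow> snd s 2 (fst s' 3) \<noteq> 1) \<and> fst s' 3 < n)"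
      using that w by (intro ends_in_search) auto
    then show ?thesis by (rule ends_in_mono) (use that in auto)
  qed
  have 7: "ends_in w mark s 20 ?post" if Q: "?Q6 s" for s
  proof (rule ends_in_run)
    obtain J where J: "?J J s" using Q by blast
    have LJ: "L = edge ` (indices - J)"
      using J inj_on_image_set_diff[OF inj_edge, of indices J] edges_of_eq by auto
    show "safe w mark s" using Q w by (auto simp: mark_def)
    show "cost mark \<le> 20" by (simp add: mark_def)
    have out: "output_edges es s = L"
      using J unfolding output_eq LJ by (intro arg_cong[where f = "image edge"]) auto
    show "?post (run mark s)"
    proof (cases "fst s 1 = 1 \<and> Suc (fst s 3) < n")
      case True
      let ?i = "fst s 3"
      have odd: "odd \<beta>" using Q True by blast
      have i: "?i \<in> indices" using True length_es by (auto simp: indices_def)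
      then have iJ: "?i \<in> J" using Q True J by (metis)
      have "run mark s = (fst s, (snd s)(2 := (snd s 2)(?i := 1)))"
        using True Q by (simp add: mark_def)
      then have "output_edges es (run mark s) = edge ` (insert ?i (indices - J))"
        using J i unfolding output_eq by (intro arg_cong[where f = "image edge"]) auto
      also have "\<dots> = L \<union> {edge ?i}" using LJ by auto
      finally have "output_edges es (run mark s) = L \<union> {edge ?i}" .
      moreover have "edge ?i \<in> ?E - L" using iJ i J edges_of_eq by auto
      ultimately show ?thesis using odd by blast
    next
      case False
      then have run: "run mark s = s" using Q by (auto simp: mark_def)
      have "L = ?E" if "odd \<beta>"
      proof (cases "fst s 1 = 1")
        case True
        \<comment> \<open>The search passed all positions, so every edge is marked.\<close>
        then have "fst s 3 = length es" using False Q length_es by auto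
        then have "j \<notin> J" if "j \<in> indices" for j
          using Q J that by (auto simp: indices_def)
        then have "J = {}" using J by blast
        then show ?thesis using J by auto
      qed (use Q that in blast)
      then show ?thesis using out unfolding run by blast
    qed
  qed
  have "ends_in w outer_prog (input_state n \<beta> es)
     (20 * n + 10 + (50 * n + 5 + (2 + (200 * n + 3 + (2 + (20 * n + 10 + 20)))))) ?post"
    unfolding outer_prog_def by (intro ends_in_Seq[OF 1] ends_in_Seq[OF 2] ends_in_Seq[OF 3]
      ends_in_Seq[OF 4] ends_in_Seq[OF 5] ends_in_Seq[OF 6] 7)
  \<comment> \<open>The sum is \<open>290 * n + 52\<close>, which is at most \<open>1000 * n\<close>
    because a tree has at least one vertex.\<close>
  then show ?thesis by (rule ends_in_mono) (use n in auto)
qed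

end

section \<open>Optimality and computation in linear time\<close>

theorem theorem5:
  "(\<forall>(V :: 'a set) E (\<beta> :: nat). is_tree V E \<longrightarrow>
      (let L = outer_edges V E (\<beta> div 2); \<phi> = (\<lambda>x. x - real \<beta>) in
        (even \<beta> \<longrightarrow> optimal_contraction V E (\<lambda>_. 1) \<phi> L) \<and>
        (odd \<beta> \<longrightarrow> (\<forall>e \<in> E - L. optimal_contraction V E (\<lambda>_. 1) \<phi> (L \<union> {e})))))
   \<and>
   (\<exists>(P :: prog) (c :: nat) (k :: nat). \<forall>n es (\<beta> :: nat). tree_encoding n es \<longrightarrow>
      (let E = edges_of es; L = outer_edges {..<n} E (\<beta> div 2) in
        \<exists>t s. exec ((n + \<beta> + 2) ^ k) P (input_state n \<beta> es) t s \<and> t \<le> c * n \<and>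
          (even \<beta> \<longrightarrow> output_edges es s = L) \<and>
          (odd \<beta> \<and> L \<noteq> E \<longrightarrow> (\<exists>e \<in> E - L. output_edges es s = L \<union> {e})) \<and>
          (odd \<beta> \<and> L = E \<longrightarrow> output_edges es s = L)))"
proof (intro conjI allI impI)
  fix V :: "'a set" and E and \<beta> :: nat
  assume "is_tree V E"
  then interpret tree V E by unfold_locales
  show "let L = outer_edges V E (\<beta> div 2); \<phi> = (\<lambda>x. x - real \<beta>) in
        (even \<beta> \<longrightarrow> optimal_contraction V E (\<lambda>_. 1) \<phi> L) \<and>
        (odd \<beta> \<longrightarrow> (\<forall>e \<in> E - L. optimal_contraction V E (\<lambda>_. 1) \<phi> (L \<union> {e})))"
    unfolding Let_def using optimal_even optimal_odd by blast
next
  show "\<exists>(P :: prog) (c :: nat) (k :: nat). \<forall>n es (\<beta> :: nat). tree_encoding n es \<longrightarrow>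
      (let E = edges_of es; L = outer_edges {..<n} E (\<beta> div 2) in
        \<exists>t s. exec ((n + \<beta> + 2) ^ k) P (input_state n \<beta> es) t s \<and> t \<le> c * n \<and>
          (even \<beta> \<longrightarrow> output_edges es s = L) \<and>
          (odd \<beta> \<and> L \<noteq> E \<longrightarrow> (\<exists>e \<in> E - L. output_edges es s = L \<union> {e})) \<and>
          (odd \<beta> \<and> L = E \<longrightarrow> output_edges es s = L))"
  proof (rule exI[of _ outer_prog], rule exI[of _ 1000], rule exI[of _ 2], intro allI impI)
    fix n es and \<beta> :: nat
    assume "tree_encoding n es"
    then interpret tree_input n es by unfold_locales
    \<comment> \<open>The exponent 2 leaves room for the index sums; words have O(log(n + \<beta> +
      2)) bits.\<close>
    have "n + \<beta> + n * n \<le> (n + \<beta> + 2) ^ 2" by (simp add: power2_eq_square algebra_simps)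
    from ends_in_outer_prog[OF this]
    show "let E = edges_of es; L = outer_edges {..<n} E (\<beta> div 2) in
        \<exists>t s. exec ((n + \<beta> + 2) ^ 2) outer_prog (input_state n \<beta> es) t s \<and> t \<le> 1000 * n \<and>
          (even \<beta> \<longrightarrow> output_edges es s = L) \<and>
          (odd \<beta> \<and> L \<noteq> E \<longrightarrow> (\<exists>e \<in> E - L. output_edges es s = L \<union> {e})) \<and>
          (odd \<beta> \<and> L = E \<longrightarrow> output_edges es s = L)"
      unfolding Let_def ends_in_def by blast
  qed
qed

end
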